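(* Let $g>0$, $\Omega>0$, $\rho_0>0$, and let $\rho(x)=\rho_0+\rho_1(x)$, where $\rho_1:\mathbb{R}\to\mathbb{R}$ is an essentially bounded, compactly supported function ($\rho_1\in L^\infty_c(\mathbb{R})$). Set $\omega_{\pm}=\frac12\left(\Omega\pm\sqrt{\Omega^2+4g^2\rho_0}\right)$, $G_-=(-\infty,\omega_-)$ and $G_+=(\Omega,\omega_+)$. Consider the system $$-\partial_x^2\psi+g\rho(x)\alpha=\omega\psi,\qquad g\psi+\Omega\alpha=\omega\alpha,$$ with $\psi\in L^2(\mathbb{R})$ and $\alpha\in L^2(\mathbb{R},\rho(x)\,dx)$. (i) If $\rho_1\ge 0$ and $\rho_1\not\equiv 0$, then there exists at least one $\omega\in G_-$ for which the system has a nontrivial solution $(\psi,\alpha)$. (ii) If $\rho_1\le 0$, $\rho_1\not\equiv 0$, and there exists $\rho_*>0$ such that $\rho(x)\ge\rho_*$, then there exists at least one $\omega\in G_+$ for which the system has a nontrivial solution $(\psi,\alpha)$.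
   Context: A nontrivial solution $(\psi,\alpha)$ of the system for a given $\omega\in\mathbb{R}$ is called a bound state with frequency $\omega$. Derivatives are understood in the weak sense; equivalently $\psi\in H^2(\mathbb{R})$. Inequalities between functions and the statement $\rho_1\not\equiv0$ are understood almost everywhere. *)

theory Defs
  imports "HOL-Analysis.Analysis"
begin

definition L2 :: "'a measure \<Rightarrow> ('a \<Rightarrow> complex) \<Rightarrow> bool" where
  "L2 M f \<longleftrightarrow> f \<in> borel_measurable M \<and> integrable M (\<lambda>x. (norm (f x))\<^sup>2)"

text \<open>For an almost everywhere defined function, having compact (essential) support means
  vanishing almost everywhere outside some compact set.\<close>

definition Linf_c :: "(real \<Rightarrow> real) \<Rightarrow> bool" where
  "Linf_c f \<longleftrightarrow> f \<in> borel_measurable lebesgue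
     \<and> (\<exists>C. AE x in lebesgue. \<bar>f x\<bar> \<le> C)
     \<and> (\<exists>K. compact K \<and> (AE x in lebesgue. x \<notin> K \<longrightarrow> f x = 0))"

definition test_function :: "(real \<Rightarrow> real) \<Rightarrow> bool" where
  "test_function \<phi> \<longleftrightarrow> (\<forall>n. (deriv ^^ n) \<phi> differentiable_on UNIV)
     \<and> compact (closure {x. \<phi> x \<noteq> 0})"

definition locally_integrable :: "(real \<Rightarrow> complex) \<Rightarrow> bool" where
  "locally_integrable f \<longleftrightarrow> (\<forall>K. compact K \<longrightarrow> set_integrable lebesgue K f)"

text \<open>By linearity, testing against real-valued functions is the same as testing against
  complex-valued ones.\<close>

definition has_weak_derivative :: "(real \<Rightarrow> complex) \<Rightarrow> (real \<Rightarrow> complex) \<Rightarrow> bool" where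
  "has_weak_derivative f f' \<longleftrightarrow> locally_integrable f \<and> locally_integrable f'
     \<and> (\<forall>\<phi>. test_function \<phi> \<longrightarrow>
          (LINT x|lebesgue. deriv \<phi> x *\<^sub>R f x) = - (LINT x|lebesgue. \<phi> x *\<^sub>R f' x))"

text \<open>The measure \<open>\<rho>(x) dx\<close>; it is the intended one when \<open>\<rho> \<ge> 0\<close> almost everywhere, since
  \<^const>\<open>ennreal\<close> truncates negative values to 0.\<close>

definition weighted :: "(real \<Rightarrow> real) \<Rightarrow> real measure" where
  "weighted \<rho> = density lebesgue (\<lambda>x. ennreal (\<rho> x))"

text \<open>\<open>\<psi>\<close> is required to lie in \<open>H\<^sup>2(\<real>)\<close>, with weak derivatives \<open>\<psi>'\<close> and \<open>\<psi>''\<close>.\<close>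

definition solves_system ::
  "real \<Rightarrow> real \<Rightarrow> (real \<Rightarrow> real) \<Rightarrow> real \<Rightarrow> (real \<Rightarrow> complex) \<Rightarrow> (real \<Rightarrow> complex) \<Rightarrow> bool" where
  "solves_system g \<Omega> \<rho> \<omega> \<psi> \<alpha> \<longleftrightarrow>
     L2 lebesgue \<psi> \<and> L2 (weighted \<rho>) \<alpha>
     \<and> (\<exists>\<psi>' \<psi>''. has_weak_derivative \<psi> \<psi>' \<and> has_weak_derivative \<psi>' \<psi>''
          \<and> L2 lebesgue \<psi>' \<and> L2 lebesgue \<psi>''
          \<and> (AE x in lebesgue.
               - \<psi>'' x + of_real (g * \<rho> x) * \<alpha> x = of_real \<omega> * \<psi> x))
     \<and> (AE x in lebesgue. of_real g * \<psi> x + of_real \<Omega> * \<alpha> x = of_real \<omega> * \<alpha> x)"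

definition bound_state ::
  "real \<Rightarrow> real \<Rightarrow> (real \<Rightarrow> real) \<Rightarrow> real \<Rightarrow> (real \<Rightarrow> complex) \<Rightarrow> (real \<Rightarrow> complex) \<Rightarrow> bool" where
  "bound_state g \<Omega> \<rho> \<omega> \<psi> \<alpha> \<longleftrightarrow> solves_system g \<Omega> \<rho> \<omega> \<psi> \<alpha>
     \<and> \<not> ((AE x in lebesgue. \<psi> x = 0) \<and> (AE x in weighted \<rho>. \<alpha> x = 0))"

definition omega_minus :: "real \<Rightarrow> real \<Rightarrow> real \<Rightarrow> real" where
  "omega_minus g \<Omega> \<rho>0 = (\<Omega> - sqrt (\<Omega>\<^sup>2 + 4 * g\<^sup>2 * \<rho>0)) / 2"

definition omega_plus :: "real \<Rightarrow> real \<Rightarrow> real \<Rightarrow> real" where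
  "omega_plus g \<Omega> \<rho>0 = (\<Omega> + sqrt (\<Omega>\<^sup>2 + 4 * g\<^sup>2 * \<rho>0)) / 2"

definition G_minus :: "real \<Rightarrow> real \<Rightarrow> real \<Rightarrow> real set" where
  "G_minus g \<Omega> \<rho>0 = {..<omega_minus g \<Omega> \<rho>0}"

definition G_plus :: "real \<Rightarrow> real \<Rightarrow> real \<Rightarrow> real set" where
  "G_plus g \<Omega> \<rho>0 = {\<Omega><..<omega_plus g \<Omega> \<rho>0}"

end

theory Submission
  imports Defs
begin

text \<open>Eliminating \<open>\<alpha> = g \<psi> / (\<omega> - \<Omega>)\<close> leaves the Schroedinger equation
  \<open>\<psi>'' = (p \<omega> - c \<omega> * W) \<psi>\<close> with \<open>W = \<bar>\<rho>1\<bar>\<close> and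
  \<open>p \<omega> = g\<^sup>2 \<rho>0 / (\<omega> - \<Omega>) - \<omega>\<close>, which is positive inside the gap and vanishes at its edge
  \<open>\<omega>\<^sub>\<plusminus>\<close>. One shoots from the left end of a support interval \<open>[-R, R]\<close> with the decaying
  exponential \<open>(u, v) = (1, sqrt (p \<omega>))\<close> and looks at \<open>F \<omega> = v(R) + sqrt (p \<omega>) u(R)\<close>, whose
  vanishing means that the solution also decays to the right. Deep inside the gap
  \<open>p - c W \<ge> 0\<close>, so \<open>u\<close> and \<open>F\<close> are positive; at the edge a positive \<open>u\<close> would give
  \<open>F = - c \<integral> W u < 0\<close>. At the first \<open>\<omega>\<close> where positivity of \<open>u\<close> or of \<open>F\<close> is lost, \<open>u \<ge> 0\<close> has no
  double zero, so \<open>u > 0\<close> and \<open>F = 0\<close>.\<close>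

subsection \<open>Primitives of bounded measurable functions\<close>

text \<open>Hence positivity of \<open>u\<close> and of \<open>F\<close> is followed together, up to
  the first parameter at which either fails; that parameter exists by compactness, which needs
  \<open>u\<close> continuous in parameter and position jointly.

  Since \<open>W\<close> is merely bounded and measurable, \<open>u\<close> need not have a
  classical second derivative. The equation is therefore kept as two integral identities,
  \<open>v\<close> being the density of \<open>u\<close> and \<open>(p - c W) u\<close> the density
  of \<open>v\<close>; the same identities yield the weak derivatives in the end.

  The sign of \<rho>1 and the gap belong together because the coupling \<open>c\<close> is minus
  that sign times \<open>g\<^sup>2 / (\<omega> - \<Omega>)\<close>, and it must be positive. Deep
  inside the gap means very negative \<omega> in (i), where the term -\<omega> dominates, and
  \<omega> slightly above \<Omega> in (ii), where
  \<open>g\<^sup>2 * \<rho> / (\<omega> - \<Omega>)\<close> is large because \<rho> is bounded away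
  from zero.\<close>

lemma quadratic_increments_imp_constant:
  fixes D :: "real \<Rightarrow> real"
  assumes "a \<le> b"
    and D: "\<And>x y. a \<le> x \<Longrightarrow> x \<le> y \<Longrightarrow> y \<le> b \<Longrightarrow> \<bar>D y - D x\<bar> \<le> C * (y - x)\<^sup>2"
  shows "D b = D a"
proof -
  have D': "\<bar>D y - D x\<bar> \<le> C * (y - x)\<^sup>2" if "x \<in> {a..b}" "y \<in> {a..b}" for x y
    using D[of x y] D[of y x] that
    by (cases "x \<le> y") (auto simp: abs_minus_commute power2_commute[of x y])
  \<comment> \<open>The difference quotients are at most \<open>C * \<bar>y - x\<bar>\<close>, so
    the derivative vanishes everywhere, not just almost everywhere.\<close>
  have "(D has_field_derivative 0) (at x within {a..b})" if x: "x \<in> {a..b}" for x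
    unfolding has_field_derivative_iff
  proof (rule Lim_null_comparison)
    have "norm ((D y - D x) / (y - x)) \<le> C * \<bar>y - x\<bar>" if "y \<in> {a..b}" "y \<noteq> x" for y
    proof -
      have "\<bar>D y - D x\<bar> / \<bar>y - x\<bar> \<le> C * (y - x)\<^sup>2 / \<bar>y - x\<bar>"
        using D'[OF x \<open>y \<in> {a..b}\<close>] by (intro divide_right_mono) auto
      also have "\<dots> = C * \<bar>y - x\<bar>"
        using that by (simp add: field_simps power2_eq_square abs_mult_self_eq)
      finally show ?thesis by (simp add: abs_divide)
    qed
    then show "\<forall>\<^sub>F y in at x within {a..b}. norm ((D y - D x) / (y - x)) \<le> C * \<bar>y - x\<bar>"
      unfolding eventually_at_filter by auto
    show "((\<lambda>y. C * \<bar>y - x\<bar>) \<longlongrightarrow> 0) (at x within {a..b})"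
      by (auto intro!: tendsto_eq_intros)
  qed
  then obtain c where "\<forall>x\<in>{a..b}. D x = c"
    using has_field_derivative_zero_constant[of "{a..b}" D] by auto
  with \<open>a \<le> b\<close> show ?thesis by auto
qed

lemma continuous_on_compact_abs_bound:
  fixes f :: "'a::topological_space \<Rightarrow> real"
  assumes "continuous_on S f" "compact S"
  obtains B where "\<And>x. x \<in> S \<Longrightarrow> \<bar>f x\<bar> \<le> B"
proof -
  have "bounded (f ` S)"
    using assms by (intro compact_imp_bounded compact_continuous_image)
  then obtain B where "\<forall>y\<in>f ` S. norm y \<le> B"
    unfolding bounded_iff by blast
  then show thesis by (intro that[of B]) auto
qed

lemma bounded_measurable_integrable_on:
  fixes f :: "real \<Rightarrow> real"
  assumes "f \<in> borel_measurable (lebesgue_on {a..b})" "\<And>x. x \<in> {a..b} \<Longrightarrow> \<bar>f x\<bar> \<le> M"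
  shows "f integrable_on {a..b}"
  by (rule measurable_bounded_by_integrable_imp_integrable[where g="\<lambda>_. M"])
     (use assms in \<open>auto intro: integrable_const_ivl\<close>)

lemma abs_has_integral_le:
  fixes f :: "real \<Rightarrow> real"
  assumes "(f has_integral I) {x..y}" "x \<le> y" "\<And>t. t \<in> {x..y} \<Longrightarrow> \<bar>f t\<bar> \<le> M"
  shows "\<bar>I\<bar> \<le> M * (y - x)"
proof -
  have "0 \<le> M" using assms(2) assms(3)[of x] by auto
  then show ?thesis
    using has_integral_bound[of M f I x y] assms by simp
qed

text \<open>The library has no integration by parts for primitives of merely bounded functions.
  Here the defect over \<open>[x, y]\<close> is quadratic in \<open>y - x\<close>, hence zero.\<close>

lemma has_integral_product_of_primitives:
  fixes f g F G :: "real \<Rightarrow> real"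
  assumes "a \<le> b"
    and f: "f \<in> borel_measurable lebesgue" "\<And>x. x \<in> {a..b} \<Longrightarrow> \<bar>f x\<bar> \<le> M"
    and g: "g \<in> borel_measurable lebesgue" "\<And>x. x \<in> {a..b} \<Longrightarrow> \<bar>g x\<bar> \<le> M"
    and F: "\<And>x y. a \<le> x \<Longrightarrow> x \<le> y \<Longrightarrow> y \<le> b \<Longrightarrow> (f has_integral F y - F x) {x..y}"
    and G: "\<And>x y. a \<le> x \<Longrightarrow> x \<le> y \<Longrightarrow> y \<le> b \<Longrightarrow> (g has_integral G y - G x) {x..y}"
  shows "((\<lambda>t. f t * G t + F t * g t) has_integral F b * G b - F a * G a) {a..b}"
proof -
  have "0 \<le> M" using f(2)[of a] \<open>a \<le> b\<close> by auto
  have lip: "\<bar>P y - P x\<bar> \<le> M * (y - x)"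
    if "\<And>x. x \<in> {a..b} \<Longrightarrow> \<bar>p x\<bar> \<le> M"
      "\<And>x y. a \<le> x \<Longrightarrow> x \<le> y \<Longrightarrow> y \<le> b \<Longrightarrow> (p has_integral P y - P x) {x..y}"
      "a \<le> x" "x \<le> y" "y \<le> b" for p P x y
    using that by (intro abs_has_integral_le[of p]) auto
  have lipF: "\<bar>F y - F x\<bar> \<le> M * (y - x)" if "a \<le> x" "x \<le> y" "y \<le> b" for x y
    by (rule lip[of f]) (use f(2) F that in auto)
  have lipG: "\<bar>G y - G x\<bar> \<le> M * (y - x)" if "a \<le> x" "x \<le> y" "y \<le> b" for x y
    by (rule lip[of g]) (use g(2) G that in auto)
  have cont: "continuous_on {a..b} P"
    if "\<And>x y. a \<le> x \<Longrightarrow> x \<le> y \<Longrightarrow> y \<le> b \<Longrightarrow> \<bar>P y - P x\<bar> \<le> M * (y - x)" for P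
  proof (rule lipschitz_on_continuous_on[OF lipschitz_onI])
    fix x y assume "x \<in> {a..b}" "y \<in> {a..b}"
    then show "dist (P x) (P y) \<le> M * dist x y"
      using that[of x y] that[of y x]
      by (cases "x \<le> y") (auto simp: dist_real_def abs_minus_commute)
  qed fact
  have contF: "continuous_on {a..b} F" by (rule cont[OF lipF])
  have contG: "continuous_on {a..b} G" by (rule cont[OF lipG])
  define h where "h = (\<lambda>t. f t * G t + F t * g t)"
  have h: "h integrable_on {x..y}" if "a \<le> x" "y \<le> b" for x y
  proof -
    have sub: "{x..y} \<subseteq> {a..b}" using that by auto
    obtain B1 where B1: "\<And>t. t \<in> {a..b} \<Longrightarrow> \<bar>F t\<bar> \<le> B1"
      using continuous_on_compact_abs_bound[OF contF compact_Icc] by metis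
    obtain B2 where B2: "\<And>t. t \<in> {a..b} \<Longrightarrow> \<bar>G t\<bar> \<le> B2"
      using continuous_on_compact_abs_bound[OF contG compact_Icc] by metis
    show ?thesis
    proof (rule bounded_measurable_integrable_on)
      have [measurable]: "f \<in> borel_measurable (lebesgue_on {x..y})" "g \<in> borel_measurable (lebesgue_on {x..y})"
        "F \<in> borel_measurable (lebesgue_on {x..y})" "G \<in> borel_measurable (lebesgue_on {x..y})"
        using f(1) g(1) continuous_on_subset[OF contF sub] continuous_on_subset[OF contG sub]
        by (auto intro: measurable_restrict_space1 continuous_imp_measurable_on_sets_lebesgue)
      show "h \<in> borel_measurable (lebesgue_on {x..y})"
        unfolding h_def by measurable
      fix t assume "t \<in> {x..y}"
      then have t: "t \<in> {a..b}" using sub by auto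
      have "\<bar>h t\<bar> \<le> \<bar>f t\<bar> * \<bar>G t\<bar> + \<bar>F t\<bar> * \<bar>g t\<bar>"
        unfolding h_def by (metis abs_mult abs_triangle_ineq)
      also have "\<dots> \<le> M * B2 + B1 * M"
        using f(2)[OF t] g(2)[OF t] B1[OF t] B2[OF t] by (intro add_mono mult_mono) auto
      finally show "\<bar>h t\<bar> \<le> M * B2 + B1 * M" .
    qed
  qed
  define D where "D = (\<lambda>x. F x * G x - integral {a..x} h)"
  have "\<bar>D y - D x\<bar> \<le> 2 * M\<^sup>2 * (y - x)\<^sup>2" if xy: "a \<le> x" "x \<le> y" "y \<le> b" for x y
  proof -
    have "integral {a..x} h + integral {x..y} h = integral {a..y} h"
      using xy h by (intro Henstock_Kurzweil_Integration.integral_combine) auto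
    then have D: "D y - D x = F y * G y - F x * G x - integral {x..y} h"
      by (simp add: D_def)
    \<comment> \<open>Freezing \<open>G\<close> at the right end and \<open>F\<close> at the left
      end makes the two increments telescope to exactly \<open>F y * G y - F x * G x\<close>. What
      remains is an integrand of size \<open>2 * M\<^sup>2 * (y - x)\<close> on an interval of
      length \<open>y - x\<close>.\<close>
    have 1: "((\<lambda>t. f t * G y + F x * g t) has_integral (F y - F x) * G y + F x * (G y - G x)) {x..y}"
      using F[OF xy] G[OF xy] by (intro has_integral_add has_integral_mult_left has_integral_mult_right)
    have "((\<lambda>t. f t * G y + F x * g t - h t) has_integral
        ((F y - F x) * G y + F x * (G y - G x) - integral {x..y} h)) {x..y}"
      using xy h by (intro has_integral_diff[OF 1]) auto
    then have "((\<lambda>t. f t * (G y - G t) + (F x - F t) * g t) has_integral D y - D x) {x..y}"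
      unfolding D h_def by (simp add: algebra_simps)
    then have "\<bar>D y - D x\<bar> \<le> (2 * M\<^sup>2 * (y - x)) * (y - x)"
    proof (rule abs_has_integral_le)
      fix t assume t: "t \<in> {x..y}"
      have FG: "\<bar>G y - G t\<bar> \<le> M * (y - x)" "\<bar>F x - F t\<bar> \<le> M * (y - x)"
      proof -
        have "\<bar>G y - G t\<bar> \<le> M * (y - t)" using lipG[of t y] t xy by auto
        also have "\<dots> \<le> M * (y - x)" using t \<open>0 \<le> M\<close> by (intro mult_left_mono) auto
        finally show "\<bar>G y - G t\<bar> \<le> M * (y - x)" .
        have "\<bar>F x - F t\<bar> \<le> M * (t - x)" using lipF[of x t] t xy by (auto simp: abs_minus_commute)
        also have "\<dots> \<le> M * (y - x)" using t \<open>0 \<le> M\<close> by (intro mult_left_mono) auto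
        finally show "\<bar>F x - F t\<bar> \<le> M * (y - x)" .
      qed
      have "\<bar>f t * (G y - G t) + (F x - F t) * g t\<bar> \<le> \<bar>f t\<bar> * \<bar>G y - G t\<bar> + \<bar>F x - F t\<bar> * \<bar>g t\<bar>"
        by (metis abs_mult abs_triangle_ineq)
      also have "\<dots> \<le> M * (M * (y - x)) + M * (y - x) * M"
        using f(2)[of t] g(2)[of t] FG t xy \<open>0 \<le> M\<close> by (intro add_mono mult_mono) auto
      finally show "\<bar>f t * (G y - G t) + (F x - F t) * g t\<bar> \<le> 2 * M\<^sup>2 * (y - x)"
        by (simp add: power2_eq_square algebra_simps)
    qed (use xy in auto)
    then show ?thesis by (simp add: power2_eq_square mult.assoc)
  qed
  from quadratic_increments_imp_constant[OF \<open>a \<le> b\<close> this]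
  have "integral {a..b} h = F b * G b - F a * G a"
    by (simp add: D_def)
  then show ?thesis
    using integrable_integral[OF h[of a b]] unfolding h_def by simp
qed

text \<open>The integral of \<open>exp (M * t)\<close> up to \<open>x\<close> is at most
  \<open>exp (M * x) / M\<close>, whatever the length of the interval. In the weighted norm
  integration thus gains a factor \<open>1 / M\<close>, which is the source of the contraction
  below.\<close>

lemma weighted_integral_bound:
  fixes h :: "real \<Rightarrow> real"
  assumes "0 < M" "a \<le> x" "h \<in> borel_measurable (lebesgue_on {a..x})"
    and h: "\<And>t. t \<in> {a..x} \<Longrightarrow> \<bar>h t\<bar> \<le> K"
  shows "\<bar>exp (- M * x) * integral {a..x} (\<lambda>t. exp (M * t) * h t)\<bar> \<le> K / M"
proof -
  have "0 \<le> K" using h[of a] \<open>a \<le> x\<close> by auto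
  have "((\<lambda>t. K * exp (M * t)) has_integral (K * exp (M * x) / M - K * exp (M * a) / M)) {a..x}"
    using \<open>0 < M\<close> \<open>a \<le> x\<close>
    by (intro fundamental_theorem_of_calculus)
       (auto intro!: derivative_eq_intros simp flip: has_real_derivative_iff_has_vector_derivative)
  moreover have "(\<lambda>t. exp (M * t)) \<in> borel_measurable (lebesgue_on {a..x})"
    by (intro continuous_imp_measurable_on_sets_lebesgue continuous_intros) auto
  ultimately have "\<bar>integral {a..x} (\<lambda>t. exp (M * t) * h t)\<bar> \<le> K * exp (M * x) / M - K * exp (M * a) / M"
    using assms h unfolding real_norm_def[symmetric]
    by (intro integral_norm_bound_integral'[where g="\<lambda>t. K * exp (M * t)"])
       (auto simp: abs_mult mult.commute[of K] intro!: borel_measurable_times)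
  also have "\<dots> \<le> K * exp (M * x) / M" using \<open>0 \<le> K\<close> \<open>0 < M\<close> by simp
  finally have "exp (- M * x) * \<bar>integral {a..x} (\<lambda>t. exp (M * t) * h t)\<bar> \<le> exp (- M * x) * (K * exp (M * x) / M)"
    by (intro mult_left_mono) auto
  also have "\<dots> = K / M"
    by (simp add: exp_minus field_simps)
  finally show ?thesis by (simp add: abs_mult)
qed

text \<open>Dominated convergence along a sequence of pairs: the indicators of the varying intervals
  converge at every \<open>t\<close> except the limiting endpoint, a null set. Continuity of
  \<open>W\<close> is never involved.\<close>

lemma continuous_on_parametric_indefinite_integral:
  fixes \<Phi> :: "real \<times> real \<Rightarrow> real"
  assumes \<Phi>: "continuous_on UNIV \<Phi>"
    and W: "W \<in> borel_measurable lebesgue" "\<And>t. \<bar>W t\<bar> \<le> C"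
  shows "continuous_on (UNIV \<times> {a..b}) (\<lambda>(w, x). integral {a..x} (\<lambda>t. W t * \<Phi> (w, t)))"
proof (rule continuous_on_sequentiallyI)
  fix z :: "nat \<Rightarrow> real \<times> real" and z0
  assume z: "\<forall>n. z n \<in> UNIV \<times> {a..b}" "z0 \<in> UNIV \<times> {a..b}" "z \<longlonglongrightarrow> z0"
  have \<Phi>_meas: "(\<lambda>t. \<Phi> (w, t)) \<in> borel_measurable lebesgue" for w
  proof -
    have "continuous_on UNIV (\<lambda>t. \<Phi> (w, t))"
      by (intro continuous_on_compose2[OF \<Phi>] continuous_intros) auto
    then show ?thesis
      by (intro measurable_completion) (simp add: borel_measurable_continuous_onI)
  qed
  have meas: "(\<lambda>t. indicat_real {a..x} t * (W t * \<Phi> (w, t))) \<in> borel_measurable lebesgue" for w x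
    by (intro borel_measurable_times borel_measurable_indicator W(1) \<Phi>_meas) auto
  \<comment> \<open>A convergent sequence of parameters is bounded, so \<Phi> needs a bound only on
    a compact rectangle; this gives the dominating function.\<close>
  obtain m where m: "\<And>n. norm (fst (z n)) \<le> m"
    using convergent_imp_bounded[OF tendsto_fst[OF z(3)]] by (auto simp: bounded_iff)
  have m0: "norm (fst z0) \<le> m"
    using m by (intro LIMSEQ_le_const2[OF tendsto_norm[OF tendsto_fst[OF z(3)]]]) auto
  have "compact ({-m..m} \<times> {a..b})" by (intro compact_Times compact_Icc)
  then obtain B where "\<And>z. z \<in> {-m..m} \<times> {a..b} \<Longrightarrow> \<bar>\<Phi> z\<bar> \<le> B"
    using continuous_on_compact_abs_bound[OF continuous_on_subset[OF \<Phi> subset_UNIV]] by metis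
  then have B: "\<And>w t. w \<in> {-m..m} \<Longrightarrow> t \<in> {a..b} \<Longrightarrow> \<bar>\<Phi> (w, t)\<bar> \<le> B" by auto
  have C: "0 \<le> C" using W(2)[of 0] by auto
  have bd: "norm (indicator {a..x} t * (W t * \<Phi> (w, t))) \<le> indicator {a..b} t * (C * B)"
    if "\<bar>w\<bar> \<le> m" "x \<le> b" for w x t
  proof (cases "t \<in> {a..x}")
    case True
    then have "\<bar>W t\<bar> * \<bar>\<Phi> (w, t)\<bar> \<le> C * B"
      using B[of w t] W(2)[of t] C that by (intro mult_mono) (auto simp: abs_le_iff)
    then show ?thesis using True that by (auto simp: abs_mult)
  next
    case False
    then have "t \<in> {a..b} \<Longrightarrow> 0 \<le> B" using B[of w t] that by force
    with False C show ?thesis by (auto simp: indicator_def)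
  qed
  have dom: "integrable lebesgue (\<lambda>t. indicator {a..b} t * (C * B))"
    by (intro integrable_mult_left) (auto simp: integrable_indicator_iff emeasure_lborel_Icc_eq)
  have eq: "integral {a..x} (\<lambda>t. W t * \<Phi> (w, t)) = (LINT t|lebesgue. indicator {a..x} t * (W t * \<Phi> (w, t)))"
    if "\<bar>w\<bar> \<le> m" "x \<le> b" for w x
  proof -
    have "set_integrable lebesgue {a..x} (\<lambda>t. W t * \<Phi> (w, t))"
      unfolding set_integrable_def real_scaleR_def
      using bd[OF that] by (intro Bochner_Integration.integrable_bound[OF dom] meas) (auto intro!: AE_I2 order_trans[OF _ abs_ge_self])
    from set_lebesgue_integral_eq_integral(2)[OF this] show ?thesis
      by (simp add: set_lebesgue_integral_def)
  qed
  have "(\<lambda>n. LINT t|lebesgue. indicator {a..snd (z n)} t * (W t * \<Phi> (fst (z n), t)))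
     \<longlonglongrightarrow> (LINT t|lebesgue. indicator {a..snd z0} t * (W t * \<Phi> (fst z0, t)))"
  proof (rule integral_dominated_convergence[OF _ _ dom])
    have "(\<lambda>n. indicator {a..snd (z n)} t * (W t * \<Phi> (fst (z n), t)))
         \<longlonglongrightarrow> indicator {a..snd z0} t * (W t * \<Phi> (fst z0, t))" if t: "t \<noteq> snd z0" for t
    proof (intro tendsto_mult tendsto_const)
      show "(\<lambda>n. indicator {a..snd (z n)} t) \<longlonglongrightarrow> (indicator {a..snd z0} t :: real)"
      proof (rule tendsto_eventually)
        consider "t < snd z0" | "t > snd z0" using t by linarith
        then show "\<forall>\<^sub>F n in sequentially. indicator {a..snd (z n)} t = (indicator {a..snd z0} t :: real)"
        proof cases
          case 1
          show ?thesis using order_tendstoD(1)[OF tendsto_snd[OF z(3)] 1]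
            by eventually_elim (use 1 in \<open>auto simp: indicator_def\<close>)
        next
          case 2
          show ?thesis using order_tendstoD(2)[OF tendsto_snd[OF z(3)] 2]
            by eventually_elim (use 2 in \<open>auto simp: indicator_def\<close>)
        qed
      qed
      show "(\<lambda>n. \<Phi> (fst (z n), t)) \<longlonglongrightarrow> \<Phi> (fst z0, t)"
        by (rule continuous_on_tendsto_compose[OF \<Phi>]) (auto intro!: tendsto_intros z(3))
    qed
    moreover have "AE t in lebesgue. t \<noteq> snd z0"
      by (rule AE_I'[where N="{snd z0}"]) (auto simp: null_sets_def)
    ultimately show "AE t in lebesgue. (\<lambda>n. indicator {a..snd (z n)} t * (W t * \<Phi> (fst (z n), t)))
         \<longlonglongrightarrow> indicator {a..snd z0} t * (W t * \<Phi> (fst z0, t))"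
      by (auto elim: eventually_mono)
    show "AE t in lebesgue. norm (indicator {a..snd (z n)} t * (W t * \<Phi> (fst (z n), t))) \<le> indicator {a..b} t * (C * B)" for n
      using bd[of "fst (z n)" "snd (z n)"] m[of n] z(1) by (intro AE_I2) (auto simp: mem_Times_iff)
  qed (rule meas)+
  then show "(\<lambda>n. case z n of (w, x) \<Rightarrow> integral {a..x} (\<lambda>t. W t * \<Phi> (w, t)))
      \<longlonglongrightarrow> (case z0 of (w, x) \<Rightarrow> integral {a..x} (\<lambda>t. W t * \<Phi> (w, t)))"
    using eq m m0 z(1,2) by (simp add: case_prod_unfold mem_Times_iff)
qed

subsection \<open>Linear equations depending on a parameter\<close>

lemma bounded_times_continuous:
  fixes W \<phi> :: "real \<Rightarrow> real"
  assumes W: "W \<in> borel_measurable lebesgue" "\<And>t. \<bar>W t\<bar> \<le> C" and \<phi>: "continuous_on {a..b} \<phi>"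
  shows borel_measurable_bounded_times_continuous: "(\<lambda>t. W t * \<phi> t) \<in> borel_measurable (lebesgue_on {a..b})"
    and integrable_on_bounded_times_continuous: "(\<lambda>t. W t * \<phi> t) integrable_on {a..b}"
proof -
  show m: "(\<lambda>t. W t * \<phi> t) \<in> borel_measurable (lebesgue_on {a..b})"
    using W(1) \<phi> by (intro borel_measurable_times measurable_restrict_space1
        continuous_imp_measurable_on_sets_lebesgue) auto
  obtain B where B: "\<And>t. t \<in> {a..b} \<Longrightarrow> \<bar>\<phi> t\<bar> \<le> B"
    using continuous_on_compact_abs_bound[OF \<phi> compact_Icc] by metis
  show "(\<lambda>t. W t * \<phi> t) integrable_on {a..b}"
  proof (rule bounded_measurable_integrable_on[OF m])
    fix t assume "t \<in> {a..b}"
    with B W(2) show "\<bar>W t * \<phi> t\<bar> \<le> C * B"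
      unfolding abs_mult by (intro mult_mono) (auto intro: order_trans[OF abs_ge_zero])
  qed
qed

text \<open>The fixed point is taken among functions of \<open>(w, x)\<close> jointly, so that continuity in the
  parameter comes for free; the weight \<open>exp (M x)\<close> makes the integral operator a contraction
  on the whole interval.\<close>

lemma linear_ode_family:
  fixes s p c W :: "real \<Rightarrow> real"
  assumes "a \<le> b"
    and cont: "continuous_on UNIV s" "continuous_on UNIV p" "continuous_on UNIV c"
    and bnd: "\<And>w. \<bar>s w\<bar> \<le> B" "\<And>w. \<bar>p w\<bar> \<le> B" "\<And>w. \<bar>c w\<bar> \<le> B"
    and W: "W \<in> borel_measurable lebesgue" "\<And>t. \<bar>W t\<bar> \<le> C"
  obtains u v :: "real \<Rightarrow> real \<Rightarrow> real"
  where "continuous_on (UNIV \<times> {a..b}) (\<lambda>(w, x). u w x)"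
    and "continuous_on (UNIV \<times> {a..b}) (\<lambda>(w, x). v w x)"
    and "\<And>w x. x \<in> {a..b} \<Longrightarrow> u w x = 1 + integral {a..x} (v w)"
    and "\<And>w x. x \<in> {a..b} \<Longrightarrow> v w x = s w + integral {a..x} (\<lambda>t. (p w - c w * W t) * u w t)"
proof -
  have B: "0 \<le> B" using bnd(1)[of 0] by auto
  have C: "0 \<le> C" using W(2)[of 0] by auto
  define Q where "Q = B + B * C"
  \<comment> \<open>With \<open>Q\<close> a bound for the coefficient, the two components of the
    operator have Lipschitz constants \<open>1 / M\<close> and \<open>Q / M\<close>; this
    \<open>M\<close> makes their sum exactly \<open>1 / 2\<close>.\<close>
  define M where "M = 2 * (1 + Q)"
  have Q: "0 \<le> Q" using B C by (simp add: Q_def)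
  have M: "0 < M" using Q by (simp add: M_def)
  define q where "q = (\<lambda>w t. p w - c w * W t)"
  have q_meas: "q w \<in> borel_measurable lebesgue" for w
    unfolding q_def using W(1) by measurable
  have q_le: "\<bar>q w t\<bar> \<le> Q" for w t
  proof -
    have "\<bar>c w\<bar> * \<bar>W t\<bar> \<le> B * C" using bnd(3) W(2) B by (intro mult_mono) auto
    with bnd(2)[of w] show ?thesis unfolding q_def Q_def abs_mult[symmetric] by linarith
  qed
  \<comment> \<open>The unknown is the rescaled pair \<Psi> = \<open>exp (- M * x) * (u, v)\<close>;
    hence the factor \<open>exp (M * t)\<close> under the integrals and \<open>exp (- M * x)\<close>
    in \<open>T\<close>.\<close>
  define J1 where "J1 = (\<lambda>(\<Psi> :: (real \<times> real) \<Rightarrow>\<^sub>C (real \<times> real)) w x. integral {a..x} (\<lambda>t. exp (M * t) * snd (\<Psi> (w, t))))"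
  define J2 where "J2 = (\<lambda>(\<Psi> :: (real \<times> real) \<Rightarrow>\<^sub>C (real \<times> real)) w x. integral {a..x} (\<lambda>t. exp (M * t) * (q w t * fst (\<Psi> (w, t)))))"
  define T where "T = (\<lambda>(\<Psi> :: (real \<times> real) \<Rightarrow>\<^sub>C (real \<times> real)) (w, x).
     (exp (- M * x) * (1 + J1 \<Psi> w x), exp (- M * x) * (s w + J2 \<Psi> w x)))"
  \<comment> \<open>Bounded continuous functions live on the whole plane, so \<open>x\<close> is
    clamped to the interval; the fixed point equation holds where \<open>r\<close> is the
    identity.\<close>
  define r where "r = (\<lambda>z :: real \<times> real. (fst z, max a (min b (snd z))))"
  have cont\<Psi>: "continuous_on S (\<lambda>t. apply_bcontfun \<Psi> (f t))" if "continuous_on S f"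
    for \<Psi> :: "(real \<times> real) \<Rightarrow>\<^sub>C (real \<times> real)" and f and S :: "'x::topological_space set"
    using that by (intro continuous_on_compose2[OF continuous_on_apply_bcontfun[of UNIV]]) auto
  have fst_le: "\<bar>fst z\<bar> \<le> norm z" and snd_le: "\<bar>snd z\<bar> \<le> norm z" for z :: "real \<times> real"
    using norm_fst_le[of "fst z" "snd z"] norm_snd_le[of "snd z" "fst z"] by simp_all
  note ci = continuous_intros cont\<Psi>
  have q_int: "(\<lambda>t. exp (M * t) * (q w t * fst (\<Psi> (w, t)))) integrable_on {a..x}"
    for \<Psi> :: "(real \<times> real) \<Rightarrow>\<^sub>C (real \<times> real)" and w x
    using integrable_on_bounded_times_continuous[OF q_meas q_le, of a x "\<lambda>t. exp (M * t) * fst (\<Psi> (w, t))"]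
    by (simp add: mult.left_commute continuous_intros cont\<Psi>)
  have i_int: "(\<lambda>t. exp (M * t) * snd (\<Psi> (w, t))) integrable_on {a..x}"
    for \<Psi> :: "(real \<times> real) \<Rightarrow>\<^sub>C (real \<times> real)" and w x
    by (intro integrable_continuous_interval ci)
  have b1: "\<bar>exp (- M * x) * integral {a..x} (\<lambda>t. exp (M * t) * \<phi> t)\<bar> \<le> K / M"
    if "continuous_on UNIV \<phi>" "\<And>t. \<bar>\<phi> t\<bar> \<le> K" "a \<le> x" for \<phi> K x
    using that M by (intro weighted_integral_bound)
      (auto intro!: continuous_imp_measurable_on_sets_lebesgue intro: continuous_on_subset)
  have b2: "\<bar>exp (- M * x) * integral {a..x} (\<lambda>t. exp (M * t) * (q w t * \<phi> t))\<bar> \<le> Q * K / M"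
    if "continuous_on UNIV \<phi>" "\<And>t. \<bar>\<phi> t\<bar> \<le> K" "a \<le> x" for \<phi> K x w
    using that M Q q_le
    by (intro weighted_integral_bound borel_measurable_bounded_times_continuous[OF q_meas])
      (auto simp: abs_mult intro!: mult_mono intro: continuous_on_subset)
  have contT: "continuous_on (UNIV \<times> {a..b}) (T \<Psi>)" for \<Psi>
  proof -
    have 1: "continuous_on (UNIV \<times> {a..b}) (\<lambda>z. J1 \<Psi> (fst z) (snd z))"
      using continuous_on_parametric_indefinite_integral
        [of "\<lambda>z. exp (M * snd z) * snd (\<Psi> z)" "\<lambda>_. 1" 1 a b]
      unfolding J1_def case_prod_unfold by (simp add: ci)
    have I: "continuous_on (UNIV \<times> {a..b}) (\<lambda>z. integral {a..snd z} (\<lambda>t. V t * (exp (M * t) * fst (\<Psi> (fst z, t)))))"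
      if "V \<in> borel_measurable lebesgue" "\<And>t. \<bar>V t\<bar> \<le> D" for V D
      using continuous_on_parametric_indefinite_integral
        [of "\<lambda>z. exp (M * snd z) * fst (\<Psi> z)" V D a b] that
      unfolding case_prod_unfold by (simp add: ci)
    \<comment> \<open>The continuity lemma wants a weight independent of the parameter, so
      \<open>p w\<close> and \<open>c w\<close> are pulled out of the integrals, leaving the weights
      \<open>1\<close> and \<open>W\<close>.\<close>
    have J2: "J2 \<Psi> w x = p w * integral {a..x} (\<lambda>t. 1 * (exp (M * t) * fst (\<Psi> (w, t))))
        - c w * integral {a..x} (\<lambda>t. W t * (exp (M * t) * fst (\<Psi> (w, t))))" for w x
    proof -
      have "integral {a..x} (\<lambda>t. p w * (1 * (exp (M * t) * fst (\<Psi> (w, t)))) - c w * (W t * (exp (M * t) * fst (\<Psi> (w, t)))))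
         = integral {a..x} (\<lambda>t. p w * (1 * (exp (M * t) * fst (\<Psi> (w, t))))) - integral {a..x} (\<lambda>t. c w * (W t * (exp (M * t) * fst (\<Psi> (w, t)))))"
        by (intro Henstock_Kurzweil_Integration.integral_diff integrable_on_mult_right
              integrable_on_bounded_times_continuous[OF W] integrable_continuous_interval ci)
      moreover have "(\<lambda>t. exp (M * t) * (q w t * fst (\<Psi> (w, t))))
         = (\<lambda>t. p w * (1 * (exp (M * t) * fst (\<Psi> (w, t)))) - c w * (W t * (exp (M * t) * fst (\<Psi> (w, t)))))"
        by (rule ext) (simp add: q_def algebra_simps)
      ultimately show ?thesis
        unfolding J2_def by simp
    qed
    have 2: "continuous_on (UNIV \<times> {a..b}) (\<lambda>z. J2 \<Psi> (fst z) (snd z))"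
      unfolding J2
      by (intro continuous_intros I[of "\<lambda>_. 1" 1] I[OF W] continuous_on_compose2[OF cont(2)] continuous_on_compose2[OF cont(3)]) auto
    show ?thesis
      unfolding T_def case_prod_unfold
      by (intro continuous_intros 1 2 continuous_on_compose2[OF cont(1)]) auto
  qed
  have r: "r z \<in> UNIV \<times> {a..b}" for z
    using \<open>a \<le> b\<close> by (auto simp: r_def)
  have "continuous_on UNIV r"
    unfolding r_def by (intro continuous_intros)
  \<comment> \<open>Here the bounds on \<open>s\<close>, \<open>p\<close> and \<open>c\<close> must
    be uniform over all parameters, as the supremum is taken over the whole plane.\<close>
  have Tb: "T \<Psi> \<circ> r \<in> bcontfun" for \<Psi>
  proof -
    obtain Y where Y: "\<And>z. norm (\<Psi> z) \<le> Y"
      using bounded_apply_bcontfun[of \<Psi>] by (auto simp: bounded_iff)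
    have "norm (T \<Psi> (w, x)) \<le> (exp (- M * a) + Y / M) + (exp (- M * a) * B + Q * Y / M)"
      if x: "x \<in> {a..b}" for w x
    proof -
      have "\<bar>exp (- M * x) * J1 \<Psi> w x\<bar> \<le> Y / M"
        unfolding J1_def using x order_trans[OF snd_le Y]
        by (intro b1 ci) auto
      moreover have "\<bar>exp (- M * x) * J2 \<Psi> w x\<bar> \<le> Q * Y / M"
        unfolding J2_def using x order_trans[OF fst_le Y]
        by (intro b2 ci) auto
      moreover have e: "exp (- M * x) \<le> exp (- M * a)" using x M by simp
      moreover have "\<bar>exp (- M * x) * s w\<bar> \<le> exp (- M * a) * B"
        unfolding abs_mult using e bnd(1) by (intro mult_mono) auto
      moreover have "\<bar>exp (- M * x)\<bar> = exp (- M * x)" by simp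
      ultimately have "\<bar>exp (- M * x) * (1 + J1 \<Psi> w x)\<bar> \<le> exp (- M * a) + Y / M"
          "\<bar>exp (- M * x) * (s w + J2 \<Psi> w x)\<bar> \<le> exp (- M * a) * B + Q * Y / M"
        unfolding distrib_left mult_1_right by linarith+
      then show ?thesis
        unfolding T_def case_prod_conv real_norm_def[symmetric]
        by (intro order_trans[OF norm_Pair_le add_mono])
    qed
    then have "norm ((T \<Psi> \<circ> r) z) \<le> (exp (- M * a) + Y / M) + (exp (- M * a) * B + Q * Y / M)" for z
      using r[of z] by (cases "r z") auto
    moreover have "continuous_on UNIV (T \<Psi> \<circ> r)"
      by (rule continuous_on_compose[OF \<open>continuous_on UNIV r\<close>])
         (rule continuous_on_subset[OF contT image_subsetI[OF r]])
    ultimately show ?thesis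
      unfolding bcontfun_def bounded_iff by blast
  qed
  define TT where "TT = (\<lambda>\<Psi>. Bcontfun (T \<Psi> \<circ> r))"
  have TT: "apply_bcontfun (TT \<Psi>) = T \<Psi> \<circ> r" for \<Psi>
    unfolding TT_def by (rule Bcontfun_inverse[OF Tb])
  have "dist (TT \<Psi>) (TT \<Xi>) \<le> 1 / 2 * dist \<Psi> \<Xi>" for \<Psi> \<Xi>
  proof (rule dist_bound)
    fix z
    obtain w x where wx: "r z = (w, x)" by force
    then have x: "a \<le> x" "x \<le> b" using r[of z] by auto
    let ?d = "dist \<Psi> \<Xi>"
    have d: "norm (\<Psi> y - \<Xi> y) \<le> ?d" for y
      using dist_bounded[of \<Psi> y \<Xi>] by (simp add: dist_norm)
    have "J1 \<Psi> w x - J1 \<Xi> w x = integral {a..x} (\<lambda>t. exp (M * t) * snd (\<Psi> (w, t) - \<Xi> (w, t)))"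
      unfolding J1_def using i_int
      by (subst Henstock_Kurzweil_Integration.integral_diff[symmetric]) (auto simp: right_diff_distrib)
    then have "\<bar>exp (- M * x) * (J1 \<Psi> w x - J1 \<Xi> w x)\<bar> \<le> ?d / M"
      using x order_trans[OF snd_le d] by (simp only:, intro b1 ci) auto
    moreover have "J2 \<Psi> w x - J2 \<Xi> w x = integral {a..x} (\<lambda>t. exp (M * t) * (q w t * fst (\<Psi> (w, t) - \<Xi> (w, t))))"
      unfolding J2_def using q_int
      by (subst Henstock_Kurzweil_Integration.integral_diff[symmetric]) (auto simp: right_diff_distrib)
    then have "\<bar>exp (- M * x) * (J2 \<Psi> w x - J2 \<Xi> w x)\<bar> \<le> Q * ?d / M"
      using x order_trans[OF fst_le d] by (simp only:, intro b2 ci) auto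
    moreover have "T \<Psi> (w, x) - T \<Xi> (w, x)
       = (exp (- M * x) * (J1 \<Psi> w x - J1 \<Xi> w x), exp (- M * x) * (J2 \<Psi> w x - J2 \<Xi> w x))"
      unfolding T_def by (simp add: algebra_simps)
    ultimately have "norm (T \<Psi> (w, x) - T \<Xi> (w, x)) \<le> ?d / M + Q * ?d / M"
      unfolding real_norm_def[symmetric]
      by (simp only:) (intro order_trans[OF norm_Pair_le add_mono])
    also have "\<dots> = 1 / 2 * ?d"
    proof -
      have "?d / M + Q * ?d / M = (1 + Q) * ?d / M"
        by (simp add: add_divide_distrib distrib_right)
      also have "1 + Q = M / 2" by (simp add: M_def)
      finally show ?thesis using M by simp
    qed
    finally show "dist (TT \<Psi> z) (TT \<Xi> z) \<le> 1 / 2 * ?d"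
      by (simp add: TT wx dist_norm)
  qed
  then obtain \<Psi> where \<Psi>: "TT \<Psi> = \<Psi>"
    using banach_fix_type[of "1/2" TT] by auto
  have fixpt: "\<Psi> (w, x) = T \<Psi> (w, x)" if "x \<in> {a..b}" for w x
    using TT[of \<Psi>] that unfolding \<Psi> by (simp add: r_def)
  define u where "u = (\<lambda>w x. exp (M * x) * fst (\<Psi> (w, x)))"
  define v where "v = (\<lambda>w x. exp (M * x) * snd (\<Psi> (w, x)))"
  have ee: "exp (M * x) * (exp (- (M * x)) * y) = y" for x y :: real
    by (simp add: exp_minus)
  show thesis
  proof
    show "continuous_on (UNIV \<times> {a..b}) (\<lambda>(w, x). u w x)" "continuous_on (UNIV \<times> {a..b}) (\<lambda>(w, x). v w x)"
      unfolding u_def v_def case_prod_unfold by (intro ci)+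
    fix w x assume x: "x \<in> {a..b}"
    show "u w x = 1 + integral {a..x} (v w)"
      unfolding u_def fixpt[OF x] v_def J1_def T_def by (simp add: ee)
    show "v w x = s w + integral {a..x} (\<lambda>t. (p w - c w * W t) * u w t)"
      unfolding u_def v_def fixpt[OF x] T_def by (simp add: J2_def q_def ee mult.left_commute)
  qed
qed

subsection \<open>Shooting\<close>

lemma has_integral_increment:
  fixes f G :: "real \<Rightarrow> real"
  assumes "f integrable_on {a..b}" and G: "\<And>x. x \<in> {a..b} \<Longrightarrow> G x = k + integral {a..x} f"
    and "a \<le> x" "x \<le> y" "y \<le> b"
  shows "(f has_integral G y - G x) {x..y}"
proof -
  have i: "f integrable_on {a..y}" "f integrable_on {x..y}"
    using assms by (auto intro: integrable_on_subinterval[OF assms(1)])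
  have "integral {a..x} f + integral {x..y} f = integral {a..y} f"
    using assms i by (intro Henstock_Kurzweil_Integration.integral_combine) auto
  then have "integral {x..y} f = G y - G x"
    using assms by (simp add: G)
  then show ?thesis using integrable_integral[OF i(2)] by simp
qed

lemma continuous_on_nonneg_at_right_end:
  fixes f :: "real \<Rightarrow> real"
  assumes "continuous_on {a..b} f" "a < b" "\<And>x. a \<le> x \<Longrightarrow> x < b \<Longrightarrow> 0 \<le> f x"
  shows "0 \<le> f b"
proof (rule continuous_ge_on_closure[of "{a..<b}" f b 0])
  show "continuous_on (closure {a..<b}) f" "b \<in> closure {a..<b}"
    using assms by auto
qed (use assms in auto)

text \<open>The points with nonpositive value form a compact set, whose minimum is the place where
  positivity first breaks down. It is applied in the space variable.\<close>

lemma compact_least_nonpos: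
  fixes f :: "real \<Rightarrow> real"
  assumes "continuous_on {a..b} f" "x \<in> {a..b}" "f x \<le> 0"
  obtains x0 where "x0 \<in> {a..b}" "f x0 \<le> 0" "\<And>y. a \<le> y \<Longrightarrow> y < x0 \<Longrightarrow> 0 < f y"
proof -
  have "closed ({a..b} \<inter> f -` {..0})"
    using assms(1) by (intro continuous_closed_preimage) auto
  then have "compact ({a..b} \<inter> f -` {..0})"
    by (simp add: compact_eq_bounded_closed bounded_Int)
  moreover have "x \<in> {a..b} \<inter> f -` {..0}" using assms by simp
  ultimately obtain x0 where "x0 \<in> {a..b} \<inter> f -` {..0}" "\<forall>y\<in>{a..b} \<inter> f -` {..0}. x0 \<le> y"
    using compact_attains_inf[of "{a..b} \<inter> f -` {..0}"] by blast
  then show thesis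
    by (intro that[of x0]) force+
qed

text \<open>Backward uniqueness for \<open>u'' = q u\<close>: on an interval shorter than \<open>1 / (1 + Q)\<close>
  the estimate \<open>sup \<bar>u\<bar> \<le> Q (\<beta> - \<alpha>)\<^sup>2 sup \<bar>u\<bar>\<close> forces \<open>u = 0\<close>.\<close>

lemma double_zero_propagates:
  fixes u v q :: "real \<Rightarrow> real"
  assumes "\<alpha> < \<beta>" "\<beta> - \<alpha> \<le> 1 / (1 + Q)" "\<And>t. \<bar>q t\<bar> \<le> Q" "continuous_on {\<alpha>..\<beta>} u"
    and u: "\<And>x y. \<alpha> \<le> x \<Longrightarrow> x \<le> y \<Longrightarrow> y \<le> \<beta> \<Longrightarrow> (v has_integral u y - u x) {x..y}"
    and v: "\<And>x y. \<alpha> \<le> x \<Longrightarrow> x \<le> y \<Longrightarrow> y \<le> \<beta> \<Longrightarrow> ((\<lambda>t. q t * u t) has_integral v y - v x) {x..y}"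
    and "u \<beta> = 0" "v \<beta> = 0"
  shows "u \<alpha> = 0"
proof -
  let ?d = "\<beta> - \<alpha>"
  have Q: "0 \<le> Q" using assms(3)[of 0] by auto
  have "continuous_on {\<alpha>..\<beta>} (\<lambda>x. \<bar>u x\<bar>)" using assms(4) by (rule continuous_intros)
  then obtain m where m: "m \<in> {\<alpha>..\<beta>}" "\<And>x. x \<in> {\<alpha>..\<beta>} \<Longrightarrow> \<bar>u x\<bar> \<le> \<bar>u m\<bar>"
    using continuous_attains_sup[of "{\<alpha>..\<beta>}" "\<lambda>x. \<bar>u x\<bar>"] \<open>\<alpha> < \<beta>\<close> by auto
  have vb: "\<bar>v x\<bar> \<le> Q * \<bar>u m\<bar> * ?d" if x: "x \<in> {\<alpha>..\<beta>}" for x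
  proof -
    have "\<bar>v \<beta> - v x\<bar> \<le> Q * \<bar>u m\<bar> * (\<beta> - x)"
    proof (rule abs_has_integral_le[OF v])
      fix t assume "t \<in> {x..\<beta>}"
      then show "\<bar>q t * u t\<bar> \<le> Q * \<bar>u m\<bar>"
        unfolding abs_mult using assms(3) m(2)[of t] x Q by (intro mult_mono) auto
    qed (use x in auto)
    also have "\<dots> \<le> Q * \<bar>u m\<bar> * ?d" using x Q by (intro mult_left_mono) auto
    finally show ?thesis using \<open>v \<beta> = 0\<close> by simp
  qed
  have "\<bar>u \<beta> - u m\<bar> \<le> Q * \<bar>u m\<bar> * ?d * (\<beta> - m)"
    by (rule abs_has_integral_le[OF u]) (use m(1) vb in auto)
  also have "\<dots> \<le> Q * \<bar>u m\<bar> * ?d * ?d" using m(1) Q by (intro mult_left_mono) auto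
  finally have "\<bar>u m\<bar> \<le> (Q * ?d * ?d) * \<bar>u m\<bar>" using \<open>u \<beta> = 0\<close> by (simp add: mult_ac)
  \<comment> \<open>The length \<open>1 / (1 + Q)\<close> gives both \<open>Q * ?d < 1\<close> and
    \<open>?d \<le> 1\<close>, so the maximum of \<bar>u\<bar> is bounded by a proper fraction of
    itself.\<close>
  moreover have "Q * ?d * ?d < 1"
  proof -
    have "(1 + Q) * ?d \<le> 1" using assms(2) Q by (simp add: field_simps)
    then have "Q * ?d < 1" using \<open>\<alpha> < \<beta>\<close> by (simp add: algebra_simps)
    moreover have "1 / (1 + Q) \<le> 1" using Q by simp
    then have "?d \<le> 1" using assms(2) by linarith
    moreover have "0 \<le> Q * ?d" using Q \<open>\<alpha> < \<beta>\<close> by simp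
    ultimately show ?thesis
      using mult_left_mono[of ?d 1 "Q * ?d"] by simp
  qed
  ultimately have "\<bar>u m\<bar> = 0"
    using mult_strict_right_mono[of "Q * ?d * ?d" 1 "\<bar>u m\<bar>"] by (cases "u m = 0") auto
  then show ?thesis using m(2)[of \<alpha>] \<open>\<alpha> < \<beta>\<close> by simp
qed

text \<open>Both gaps have their edge at the right end, so a single statement with edge
  \<open>b\<close> serves both parts. The hypothesis on \<open>p a - c a * W t\<close> says that a
  positive solution is convex at \<open>a\<close>, and \<open>Wnz\<close> is what keeps the
  parameter found away from the edge.\<close>

lemma shooting_ground_state:
  fixes p c W :: "real \<Rightarrow> real"
  assumes "a < b" "0 < R"
    and cont: "continuous_on {a..b} p" "continuous_on {a..b} c"
    and p: "\<And>w. a \<le> w \<Longrightarrow> w < b \<Longrightarrow> 0 < p w" "p b = 0" and c: "0 < c b"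
    and W: "W \<in> borel_measurable lebesgue" "\<And>t. 0 \<le> W t" "\<And>t. W t \<le> C"
    and Wsupp: "\<And>t. t \<notin> {-R..R} \<Longrightarrow> W t = 0" and Wnz: "\<not> (AE t in lebesgue. W t = 0)"
    and pa: "\<And>t. 0 \<le> p a - c a * W t"
  obtains w and u v :: "real \<Rightarrow> real"
  where "a < w" "w < b"
    and "u (-R) = 1" "v (-R) = sqrt (p w)" "v R = - sqrt (p w) * u R"
    and "\<And>x. x \<in> {-R..R} \<Longrightarrow> 0 < u x"
    and "continuous_on {-R..R} u" "continuous_on {-R..R} v"
    and "\<And>x y. -R \<le> x \<Longrightarrow> x \<le> y \<Longrightarrow> y \<le> R \<Longrightarrow> (v has_integral u y - u x) {x..y}"
    and "\<And>x y. -R \<le> x \<Longrightarrow> x \<le> y \<Longrightarrow> y \<le> R \<Longrightarrow>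
          ((\<lambda>t. (p w - c w * W t) * u t) has_integral v y - v x) {x..y}"
proof -
  \<comment> \<open>Clamping the parameter makes the coefficients continuous and bounded on the
    whole line, as \<open>linear_ode_family\<close> requires.\<close>
  define cl where "cl = (\<lambda>w. max a (min b w))"
  have cl: "cl w \<in> {a..b}" for w using \<open>a < b\<close> by (auto simp: cl_def)
  have cl_id: "cl w = w" if "w \<in> {a..b}" for w using that by (auto simp: cl_def)
  have p0: "0 \<le> p w" if "w \<in> {a..b}" for w using p(1)[of w] p(2) that by (cases "w = b") auto
  define s where "s = (\<lambda>w. sqrt (p (cl w)))"
  have contcl: "continuous_on UNIV cl" unfolding cl_def by (intro continuous_intros)
  have cp: "continuous_on UNIV (\<lambda>w. p (cl w))" and cc: "continuous_on UNIV (\<lambda>w. c (cl w))"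
    using cl by (auto intro!: continuous_on_compose2[OF _ contcl] cont)
  have cs: "continuous_on UNIV s" unfolding s_def by (intro continuous_intros cp)
  obtain B1 where B1: "\<And>w. w \<in> {a..b} \<Longrightarrow> \<bar>p w\<bar> \<le> B1"
    using continuous_on_compact_abs_bound[OF cont(1) compact_Icc] by metis
  obtain B2 where B2: "\<And>w. w \<in> {a..b} \<Longrightarrow> \<bar>c w\<bar> \<le> B2"
    using continuous_on_compact_abs_bound[OF cont(2) compact_Icc] by metis
  have "continuous_on {a..b} (\<lambda>w. sqrt (p w))" by (intro continuous_intros cont)
  then obtain B3 where B3: "\<And>w. w \<in> {a..b} \<Longrightarrow> \<bar>sqrt (p w)\<bar> \<le> B3"
    using continuous_on_compact_abs_bound[OF _ compact_Icc] by metis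
  define B where "B = max B1 (max B2 B3)"
  have B: "\<bar>s w\<bar> \<le> B" "\<bar>p (cl w)\<bar> \<le> B" "\<bar>c (cl w)\<bar> \<le> B" for w
    using B1[OF cl] B2[OF cl] B3[OF cl] unfolding B_def s_def by (simp_all add: le_max_iff_disj)
  have W': "\<bar>W t\<bar> \<le> C" for t using W by simp
  have "-R \<le> R" using \<open>0 < R\<close> by simp
  from linear_ode_family[OF this cs cp cc B W(1) W']
  obtain u v :: "real \<Rightarrow> real \<Rightarrow> real"
    where cu: "continuous_on (UNIV \<times> {-R..R}) (\<lambda>(w, x). u w x)"
      and cv: "continuous_on (UNIV \<times> {-R..R}) (\<lambda>(w, x). v w x)"
      and u_eq: "\<And>w x. x \<in> {-R..R} \<Longrightarrow> u w x = 1 + integral {-R..x} (v w)"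
      and v_eq: "\<And>w x. x \<in> {-R..R} \<Longrightarrow> v w x = s w + integral {-R..x} (\<lambda>t. (p (cl w) - c (cl w) * W t) * u w t)"
    by blast
  define q where "q = (\<lambda>w t. p (cl w) - c (cl w) * W t)"
  have v_eq': "v w x = s w + integral {-R..x} (\<lambda>t. q w t * u w t)" if "x \<in> {-R..R}" for w x
    using v_eq[OF that] by (simp add: q_def)
  have Px: "continuous_on {-R..R} (\<lambda>x. (w, x))" and Pw: "continuous_on S (\<lambda>w. (w, x))"
    for w x :: real and S
    by (intro continuous_intros)+
  have contu: "continuous_on {-R..R} (u w)" and contv: "continuous_on {-R..R} (v w)" for w
    using continuous_on_compose2[OF cu Px[of w]] continuous_on_compose2[OF cv Px[of w]] by auto
  have contuw: "continuous_on S (\<lambda>w. u w x)" and contvw: "continuous_on S (\<lambda>w. v w x)"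
    if "x \<in> {-R..R}" for x S
    using continuous_on_compose2[OF cu Pw[of S x]] continuous_on_compose2[OF cv Pw[of S x]] that
    by (simp_all add: image_subset_iff)
  define Q where "Q = B + B * C"
  have q_le: "\<bar>q w t\<bar> \<le> Q" for w t
  proof -
    have "\<bar>c (cl w)\<bar> * \<bar>W t\<bar> \<le> B * C" using B(3)[of w] W' by (intro mult_mono) auto
    with B(2)[of w] show ?thesis unfolding q_def Q_def abs_mult[symmetric] by linarith
  qed
  have q_int: "(\<lambda>t. q w t * u w t) integrable_on {-R..R}" for w
    using W(1) by (intro integrable_on_bounded_times_continuous[OF _ q_le contu]) (simp add: q_def)
  have u_inc: "(v w has_integral u w y - u w x) {x..y}"
    if "-R \<le> x" "x \<le> y" "y \<le> R" for w x y
    by (rule has_integral_increment[OF integrable_continuous_interval[OF contv] u_eq]) (use that in auto)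
  have v_inc: "((\<lambda>t. q w t * u w t) has_integral v w y - v w x) {x..y}"
    if "-R \<le> x" "x \<le> y" "y \<le> R" for w x y
    by (rule has_integral_increment[OF q_int v_eq']) (use that in auto)
  have u0: "u w (-R) = 1" and v0: "v w (-R) = s w" for w
    using u_eq[of "-R" w] v_eq[of "-R" w] \<open>0 < R\<close> by auto
  \<comment> \<open>The density \<open>v w\<close> of \<open>u w\<close> is continuous, so one-sided
    slope arguments apply to \<open>u w\<close>; the density of \<open>v w\<close> is only
    measurable.\<close>
  have u_deriv: "(u w has_real_derivative v w x) (at x within {-R..R})" if x: "x \<in> {-R..R}" for w x
  proof -
    have "((\<lambda>y. 1 + integral {-R..y} (v w)) has_real_derivative v w x) (at x within {-R..R})"
      using integral_has_real_derivative[OF contv x] by (auto intro!: derivative_eq_intros)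
    then show ?thesis
      by (rule has_field_derivative_transform_within[OF _ zero_less_one x]) (simp add: u_eq)
  qed
  have s_nonneg: "0 \<le> s w" for w by (simp add: s_def p0[OF cl])
  define F where "F = (\<lambda>w. v w R + s w * u w R)"
  have contF: "continuous_on S F" for S
    unfolding F_def using \<open>0 < R\<close>
    by (intro continuous_intros contuw contvw continuous_on_subset[OF cs]) auto
  \<comment> \<open>The bad parameters. The second part is the projection of a closed subset of a
    compact rectangle, closed because \<open>u\<close> is jointly continuous; so \<open>Z\<close> is
    compact and has a least element.\<close>
  define Z where "Z = {a..b} \<inter> F -` {..0} \<union> fst ` (({a..b} \<times> {-R..R}) \<inter> (\<lambda>(w, x). u w x) -` {..0})"
  have Z_iff: "w \<in> Z \<longleftrightarrow> w \<in> {a..b} \<and> (F w \<le> 0 \<or> (\<exists>x\<in>{-R..R}. u w x \<le> 0))" for w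
    unfolding Z_def by force
  have "compact Z"
    unfolding Z_def
  proof (intro compact_Un compact_continuous_image continuous_intros)
    have "closed ({a..b} \<inter> F -` {..0})"
      by (intro continuous_closed_preimage contF) auto
    then show "compact ({a..b} \<inter> F -` {..0})"
      by (simp add: compact_eq_bounded_closed bounded_Int)
    have "closed (({a..b} \<times> {-R..R}) \<inter> (\<lambda>(w, x). u w x) -` {..0})"
      by (intro continuous_closed_preimage continuous_on_subset[OF cu] closed_Times) auto
    then show "compact (({a..b} \<times> {-R..R}) \<inter> (\<lambda>(w, x). u w x) -` {..0})"
      by (simp add: compact_eq_bounded_closed bounded_Int bounded_Times)
  qed
  have pos_or_zero: "u w x0 = 0" if "x0 \<in> {-R..R}" "u w x0 \<le> 0" "\<And>y. -R \<le> y \<Longrightarrow> y < x0 \<Longrightarrow> 0 < u w y" for w x0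
  proof -
    have "x0 \<noteq> -R" using that(2) u0[of w] by auto
    then have "-R < x0" using that(1) by simp
    have "continuous_on {-R..x0} (u w)" using that(1) by (intro continuous_on_subset[OF contu]) auto
    from continuous_on_nonneg_at_right_end[OF this \<open>-R < x0\<close> less_imp_le[OF that(3)]]
    have "0 \<le> u w x0" .
    with that show ?thesis by simp
  qed
  have "a \<notin> Z"
  proof
    have qa: "0 \<le> q a t" for t using pa[of t] \<open>a < b\<close> by (simp add: q_def cl_id)
    \<comment> \<open>While \<open>u a\<close> is nonnegative, the nonnegative coefficient keeps
      \<open>v a\<close> above \<open>s a\<close>, hence \<open>u a\<close> above its initial value
      1. A first nonpositive point would have the value 0, which is incompatible with this.\<close>
    have grow: "u a x \<ge> 1 \<and> v a x \<ge> s a" if x: "x \<in> {-R..R}" and pos: "\<And>t. t \<in> {-R..x} \<Longrightarrow> 0 \<le> u a t" for x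
    proof -
      have v: "v a t \<ge> s a" if "t \<in> {-R..x}" for t
        using has_integral_nonneg[OF v_inc[of "-R" t a]] qa pos that x v0[of a] by auto
      have "0 \<le> u a x - u a (-R)"
        by (rule has_integral_nonneg[OF u_inc[of "-R" x a]]) (use x order_trans[OF s_nonneg v] in auto)
      with v show ?thesis using x u0[of a] by auto
    qed
    assume "a \<in> Z"
    have pos: "0 < u a x" if x: "x \<in> {-R..R}" for x
    proof (rule ccontr)
      assume "\<not> 0 < u a x"
      then have "u a x \<le> 0" by simp
      with compact_least_nonpos[OF contu x] obtain x0
        where x0: "x0 \<in> {-R..R}" "u a x0 \<le> 0" "\<And>y. -R \<le> y \<Longrightarrow> y < x0 \<Longrightarrow> 0 < u a y" by metis
      have "0 \<le> u a t" if "t \<in> {-R..x0}" for t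
        using x0(3)[of t] pos_or_zero[OF x0] that by (cases "t = x0") auto
      with grow[OF x0(1)] x0(2) show False by auto
    qed
    then have "s a \<le> v a R" "0 < u a R" using grow[of R] \<open>0 < R\<close> by (auto intro: less_imp_le)
    moreover have "0 < s a" using p(1)[of a] \<open>a < b\<close> by (simp add: s_def cl_id)
    ultimately have "0 < F a" unfolding F_def by (simp add: add_pos_pos)
    with \<open>a \<in> Z\<close> pos show False unfolding Z_iff by force
  qed
  have sb: "s b = 0" using p(2) \<open>a < b\<close> by (simp add: s_def cl_id)
  have Fb: "(\<lambda>t. W t * u b t) integrable_on {-R..R}" "F b = - c b * integral {-R..R} (\<lambda>t. W t * u b t)"
  proof -
    show "(\<lambda>t. W t * u b t) integrable_on {-R..R}"
      by (rule integrable_on_bounded_times_continuous[OF W(1) W' contu])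
    have "(\<lambda>t. q b t * u b t) = (\<lambda>t. - c b * (W t * u b t))"
      using p(2) \<open>a < b\<close> by (simp add: q_def cl_id fun_eq_iff)
    then show "F b = - c b * integral {-R..R} (\<lambda>t. W t * u b t)"
      using v_eq'[of R b] \<open>0 < R\<close> unfolding F_def by (simp add: sb)
  qed
  have "b \<in> Z"
  proof (rule ccontr)
    assume "b \<notin> Z"
    then have "0 < F b" "\<And>x. x \<in> {-R..R} \<Longrightarrow> 0 < u b x" unfolding Z_iff using \<open>a < b\<close> by force+
    moreover have "0 \<le> integral {-R..R} (\<lambda>t. W t * u b t)"
      by (rule integral_nonneg[OF Fb(1)]) (use calculation W in \<open>auto intro!: mult_nonneg_nonneg intro: less_imp_le\<close>)
    ultimately show False using c unfolding Fb(2) by (simp add: mult_less_0_iff)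
  qed
  then obtain w where w: "w \<in> Z" "\<And>z. z \<in> Z \<Longrightarrow> w \<le> z"
    using compact_attains_inf[OF \<open>compact Z\<close>] by auto
  then have "a < w" "w \<le> b" using \<open>a \<notin> Z\<close> Z_iff[of w] by (auto simp: less_le)
  have good: "0 < F z \<and> (\<forall>x\<in>{-R..R}. 0 < u z x)" if "a \<le> z" "z < w" for z
    using w(2)[of z] that \<open>w \<le> b\<close> Z_iff[of z] by (auto simp: not_le)
  have "0 \<le> F w"
    by (rule continuous_on_nonneg_at_right_end[OF contF \<open>a < w\<close>]) (use good in \<open>auto intro: less_imp_le\<close>)
  have u_nonneg: "0 \<le> u w x" if "x \<in> {-R..R}" for x
    by (rule continuous_on_nonneg_at_right_end[OF contuw[OF that] \<open>a < w\<close>]) (use good that in \<open>auto intro: less_imp_le\<close>)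
  \<comment> \<open>As a limit from smaller parameters \<open>u w\<close> is nonnegative, so its
    first zero \<open>x0\<close> is a minimum. One-sided slopes then force
    \<open>v w x0 = 0\<close>, and the double zero spreads to the left, where \<open>u w\<close> is
    positive.\<close>
  have u_pos: "0 < u w x" if x: "x \<in> {-R..R}" for x
  proof (rule ccontr)
    assume "\<not> 0 < u w x"
    then have "u w x \<le> 0" by simp
    with compact_least_nonpos[OF contu x] obtain x0
      where x0: "x0 \<in> {-R..R}" "u w x0 \<le> 0" "\<And>y. -R \<le> y \<Longrightarrow> y < x0 \<Longrightarrow> 0 < u w y" by metis
    have ux0: "u w x0 = 0" by (rule pos_or_zero[OF x0])
    then have "-R < x0" using x0(1) u0[of w] by (cases "x0 = -R") auto
    have "\<not> 0 < v w x0"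
    proof
      assume "0 < v w x0"
      then obtain d where "d > 0" and d: "\<And>h. h > 0 \<Longrightarrow> x0 - h \<in> {-R..R} \<Longrightarrow> h < d \<Longrightarrow> u w (x0 - h) < u w x0"
        using has_real_derivative_pos_inc_left[OF u_deriv[OF x0(1)]] by metis
      define h where "h = min (d / 2) (x0 + R)"
      have "h > 0" "h < d" "x0 - h \<in> {-R..R}" using \<open>d > 0\<close> \<open>-R < x0\<close> x0(1) by (auto simp: h_def)
      with d u_nonneg ux0 show False by fastforce
    qed
    \<comment> \<open>Left of \<open>R\<close> a negative slope would push \<open>u w\<close> below
      zero. At \<open>x0 = R\<close> there is no room on the right, and \<open>0 \<le> F w\<close>
      with \<open>u w R = 0\<close> supplies the sign.\<close>
    moreover have "0 \<le> v w x0"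
    proof (cases "x0 = R")
      case True
      with \<open>0 \<le> F w\<close> ux0 show ?thesis by (simp add: F_def)
    next
      case False
      show ?thesis
      proof (rule ccontr)
        assume "\<not> 0 \<le> v w x0"
        then obtain d where "d > 0" and d: "\<And>h. h > 0 \<Longrightarrow> x0 + h \<in> {-R..R} \<Longrightarrow> h < d \<Longrightarrow> u w (x0 + h) < u w x0"
          using has_real_derivative_neg_dec_right[OF u_deriv[OF x0(1)]] by (metis not_le)
        define h where "h = min (d / 2) (R - x0)"
        have "h > 0" "h < d" "x0 + h \<in> {-R..R}" using \<open>d > 0\<close> False x0(1) by (auto simp: h_def)
        with d u_nonneg ux0 show False by fastforce
      qed
    qed
    ultimately have vx0: "v w x0 = 0" by simp
    have "0 \<le> Q" using q_le[of 0 0] by simp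
    \<comment> \<open>A point strictly left of \<open>x0\<close>, still in the interval and close
      enough for the backward uniqueness estimate.\<close>
    define \<alpha> where "\<alpha> = max (-R) (x0 - 1 / (1 + Q))"
    have \<alpha>: "-R \<le> \<alpha>" "\<alpha> < x0" "x0 - \<alpha> \<le> 1 / (1 + Q)"
      using \<open>-R < x0\<close> \<open>0 \<le> Q\<close> by (auto simp: \<alpha>_def)
    have "u w \<alpha> = 0"
      by (rule double_zero_propagates[OF \<alpha>(2,3) q_le[of w], where v="v w"])
         (use \<alpha> x0(1) ux0 vx0 in \<open>auto intro!: u_inc v_inc intro: continuous_on_subset[OF contu]\<close>)
    with x0(3)[OF \<alpha>(1,2)] show False by simp
  qed
  then have Fw: "F w = 0" using w(1) \<open>0 \<le> F w\<close> unfolding Z_iff by force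
  \<comment> \<open>At the edge \<open>F b = 0\<close> makes the integral of
    \<open>W t * u b t\<close> vanish; as \<open>u b\<close> is positive on the interval,
    \<open>W\<close> would be zero almost everywhere.\<close>
  have "w \<noteq> b"
  proof
    assume "w = b"
    have nn: "0 \<le> W t * u b t" if "t \<in> {-R..R}" for t
      using u_pos[OF that] W(2)[of t] \<open>w = b\<close> by simp
    have abs: "set_integrable lebesgue {-R..R} (\<lambda>t. W t * u b t)"
      by (rule nonnegative_absolutely_integrable_1[OF Fb(1) nn])
    have "(LINT t:{-R..R}|lebesgue. W t * u b t) = 0"
      using Fw Fb(2) c \<open>w = b\<close> by (simp add: set_lebesgue_integral_eq_integral(2)[OF abs])
    then have "AE t in lebesgue. indicator {-R..R} t *\<^sub>R (W t * u b t) = 0"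
      using abs nn unfolding set_integrable_def set_lebesgue_integral_def
      by (subst (asm) integral_nonneg_eq_0_iff_AE) (auto simp: indicator_def)
    then have "AE t in lebesgue. W t = 0"
    proof eventually_elim
      case (elim t)
      then show ?case using u_pos[of t] Wsupp[of t] \<open>w = b\<close> by (cases "t \<in> {-R..R}") auto
    qed
    with Wnz show False by simp
  qed
  with \<open>w \<le> b\<close> have "w < b" by simp
  have clw: "cl w = w" using \<open>a < w\<close> \<open>w < b\<close> by (simp add: cl_id)
  show thesis
  proof (rule that[of w "u w" "v w"])
    show "v w (-R) = sqrt (p w)" using v0[of w] by (simp add: s_def clw)
    show "v w R = - sqrt (p w) * u w R" using Fw by (simp add: F_def s_def clw)
  qed (use \<open>a < w\<close> \<open>w < b\<close> u0[of w] u_pos contu contv u_inc v_inc[of _ _ w] in \<open>auto simp: q_def clw\<close>)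
qed

section \<open>Exponential tails outside the support interval\<close>

lemma has_integral_increment_glue:
  fixes f G :: "real \<Rightarrow> real"
  assumes left: "\<And>x y. x \<le> y \<Longrightarrow> y \<le> c \<Longrightarrow> (f has_integral G y - G x) {x..y}"
    and mid: "\<And>x y. c \<le> x \<Longrightarrow> x \<le> y \<Longrightarrow> y \<le> d \<Longrightarrow> (f has_integral G y - G x) {x..y}"
    and right: "\<And>x y. d \<le> x \<Longrightarrow> x \<le> y \<Longrightarrow> (f has_integral G y - G x) {x..y}"
    and "c \<le> d" "x \<le> y"
  shows "(f has_integral G y - G x) {x..y}"
proof -
  have combine: "(f has_integral G y - G x) {x..y}"
    if "x \<le> e" "e \<le> y" "(f has_integral G e - G x) {x..e}" "(f has_integral G y - G e) {e..y}" for x e y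
    using has_integral_combine[OF that] by simp
  have leftmid: "(f has_integral G y - G x) {x..y}" if "x \<le> y" "y \<le> d" for x y
    by (cases "y \<le> c"; cases "c \<le> x")
       (use that left mid combine[of x c y] in auto)
  show ?thesis
    by (cases "y \<le> d"; cases "d \<le> x")
       (use \<open>x \<le> y\<close> leftmid right combine[of x d y] in auto)
qed

text \<open>Outside the interval the equation has the constant coefficient \<open>k\<^sup>2\<close>,
  and the boundary data match both value and slope of the growing exponential on the left and the
  decaying one on the right. Matching the slopes is what lets the increments of \<psi>' be
  glued.\<close>

lemma exponential_extension:
  fixes u v V :: "real \<Rightarrow> real"
  assumes "0 < R" "0 < k"
    and V: "\<And>t. t \<notin> {-R..R} \<Longrightarrow> V t = 0"
    and bc: "u (-R) = 1" "v (-R) = k" "v R = - k * u R"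
    and u_pos: "\<And>x. x \<in> {-R..R} \<Longrightarrow> 0 < u x"
    and cont: "continuous_on {-R..R} u" "continuous_on {-R..R} v"
    and u: "\<And>x y. -R \<le> x \<Longrightarrow> x \<le> y \<Longrightarrow> y \<le> R \<Longrightarrow> (v has_integral u y - u x) {x..y}"
    and v: "\<And>x y. -R \<le> x \<Longrightarrow> x \<le> y \<Longrightarrow> y \<le> R \<Longrightarrow>
          ((\<lambda>t. (k\<^sup>2 - V t) * u t) has_integral v y - v x) {x..y}"
  obtains \<psi> \<psi>' :: "real \<Rightarrow> real" and K
  where "\<And>x. 0 < \<psi> x"
    and "\<And>x. \<bar>\<psi> x\<bar> \<le> K * exp (- k * \<bar>x\<bar>)" "\<And>x. \<bar>\<psi>' x\<bar> \<le> K * exp (- k * \<bar>x\<bar>)"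
    and "\<And>x y. x \<le> y \<Longrightarrow> (\<psi>' has_integral \<psi> y - \<psi> x) {x..y}"
    and "\<And>x y. x \<le> y \<Longrightarrow> ((\<lambda>t. (k\<^sup>2 - V t) * \<psi> t) has_integral \<psi>' y - \<psi>' x) {x..y}"
proof -
  define \<psi> where "\<psi> = (\<lambda>x. if x < -R then exp (k * (x + R)) else if x \<le> R then u x else u R * exp (- k * (x - R)))"
  define \<psi>' where "\<psi>' = (\<lambda>x. if x < -R then k * exp (k * (x + R)) else if x \<le> R then v x else - k * u R * exp (- k * (x - R)))"
  have \<psi>_left: "\<psi> x = exp (k * (x + R))" "\<psi>' x = k * exp (k * (x + R))" if "x \<le> -R" for x
    using that bc \<open>0 < R\<close> by (cases "x = -R"; simp add: \<psi>_def \<psi>'_def)+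
  have \<psi>_mid: "\<psi> x = u x" "\<psi>' x = v x" if "-R \<le> x" "x \<le> R" for x
    using that by (simp_all add: \<psi>_def \<psi>'_def)
  have \<psi>_right: "\<psi> x = u R * exp (- k * (x - R))" "\<psi>' x = - k * u R * exp (- k * (x - R))" if "R \<le> x" for x
    using that bc \<open>0 < R\<close> by (cases "x = R"; simp add: \<psi>_def \<psi>'_def)+
  have exp_int: "((\<lambda>t. A * (c * exp (c * (t - B)))) has_integral A * exp (c * (y - B)) - A * exp (c * (x - B))) {x..y}"
    if "x \<le> y" for A B c x y :: real
    using that by (intro fundamental_theorem_of_calculus)
      (auto intro!: derivative_eq_intros simp flip: has_real_derivative_iff_has_vector_derivative)
  \<comment> \<open>\<open>V\<close> may be nonzero at the points \<open>-R\<close> and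
    \<open>R\<close> themselves, where the tail identities can fail; two points do not affect the
    integrals.\<close>
  have spike: "(f has_integral I) {x..y}"
    if "(h has_integral I) {x..y}" "\<And>t. t \<in> {x..y} - {-R, R} \<Longrightarrow> f t = h t" for f h :: "real \<Rightarrow> real" and I x y
    by (rule has_integral_spike_finite[OF _ that(2) that(1), of "{-R, R}"]) auto
  obtain B1 where B1: "\<And>x. x \<in> {-R..R} \<Longrightarrow> \<bar>u x\<bar> \<le> B1"
    using continuous_on_compact_abs_bound[OF cont(1) compact_Icc] by metis
  obtain B2 where B2: "\<And>x. x \<in> {-R..R} \<Longrightarrow> \<bar>v x\<bar> \<le> B2"
    using continuous_on_compact_abs_bound[OF cont(2) compact_Icc] by metis
  \<comment> \<open>One constant for all three branches: 1 and \<open>k\<close> on the left,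
    \<open>B1\<close> and \<open>B2\<close> in the middle, \<open>B1\<close> and
    \<open>k * B1\<close> on the right. The factor \<open>exp (k * R)\<close> in \<open>K\<close>
    then compensates the decay of \<open>exp (- k * \<bar>x\<bar>)\<close> up to distance
    \<open>R\<close>.\<close>
  define L where "L = 1 + k + B1 + B2 + k * B1"
  have B0: "0 \<le> B1" "0 \<le> B2" using B1[of R] B2[of R] \<open>0 < R\<close> by auto
  have L: "1 \<le> L" "k \<le> L" "B1 \<le> L" "B2 \<le> L" "k * B1 \<le> L"
    using B0 \<open>0 < k\<close> by (simp_all add: L_def)
  define K where "K = L * exp (k * R)"
  have bound: "\<bar>\<psi> x\<bar> \<le> K * exp (- k * \<bar>x\<bar>) \<and> \<bar>\<psi>' x\<bar> \<le> K * exp (- k * \<bar>x\<bar>)" for x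
  proof -
    consider "x < -R" | "x \<in> {-R..R}" | "R < x" by force
    then show ?thesis
    proof cases
      case 1
      then have "K * exp (- k * \<bar>x\<bar>) = L * exp (k * (x + R))"
        using \<open>0 < R\<close> by (simp add: K_def mult.assoc flip: exp_add) (simp add: algebra_simps)
      then show ?thesis
        using 1 L \<open>0 < k\<close> mult_right_mono[of 1 L "exp (k * (x + R))"] mult_right_mono[of k L "exp (k * (x + R))"]
        by (simp add: \<psi>_left abs_mult)
    next
      case 2
      have "L * 1 \<le> L * exp (k * (R - \<bar>x\<bar>))"
        using 2 L \<open>0 < k\<close> by (intro mult_left_mono) auto
      also have "\<dots> = K * exp (- k * \<bar>x\<bar>)"
        by (simp add: K_def mult.assoc right_diff_distrib flip: exp_add)
      finally show ?thesis
        using 2 L B1[OF 2] B2[OF 2] by (simp add: \<psi>_mid)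
    next
      case 3
      then have e: "K * exp (- k * \<bar>x\<bar>) = L * exp (- k * (x - R))"
        using \<open>0 < R\<close> by (simp add: K_def mult.assoc flip: exp_add) (simp add: algebra_simps)
      have uR: "\<bar>u R\<bar> \<le> B1" using B1[of R] \<open>0 < R\<close> by simp
      then have "k * \<bar>u R\<bar> \<le> k * B1" using \<open>0 < k\<close> by (intro mult_left_mono) auto
      with uR L have "\<bar>u R\<bar> \<le> L" "k * \<bar>u R\<bar> \<le> L" by linarith+
      then show ?thesis
        unfolding e using 3 \<open>0 < k\<close> by (auto simp: \<psi>_right abs_mult intro!: mult_right_mono)
    qed
  qed
  show thesis
  proof (rule that[of \<psi> K \<psi>'])
    show "0 < \<psi> x" for x
      using u_pos[of x] u_pos[of R] \<open>0 < R\<close> by (auto simp: \<psi>_def)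
    show "(\<psi>' has_integral \<psi> y - \<psi> x) {x..y}" if "x \<le> y" for x y
    proof (rule has_integral_increment_glue[of "-R" \<psi>' \<psi> R, OF _ _ _ _ that])
      fix x y :: real
      assume xy: "x \<le> y"
      show "(\<psi>' has_integral \<psi> y - \<psi> x) {x..y}" if "y \<le> -R"
      proof -
        have "((\<lambda>t. 1 * (k * exp (k * (t - -R)))) has_integral \<psi> y - \<psi> x) {x..y}"
          using exp_int[OF xy, of 1 k "-R"] xy that by (simp add: \<psi>_left)
        then show ?thesis
          by (rule spike) (use that in \<open>auto simp: \<psi>_left\<close>)
      qed
      show "(\<psi>' has_integral \<psi> y - \<psi> x) {x..y}" if "-R \<le> x" "y \<le> R"
      proof -
        have "(v has_integral \<psi> y - \<psi> x) {x..y}"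
          using u[OF that(1) xy that(2)] xy that by (simp add: \<psi>_mid)
        then show ?thesis
          by (rule spike) (use that in \<open>auto simp: \<psi>_mid\<close>)
      qed
      show "(\<psi>' has_integral \<psi> y - \<psi> x) {x..y}" if "R \<le> x"
      proof -
        have "((\<lambda>t. u R * (- k * exp (- k * (t - R)))) has_integral \<psi> y - \<psi> x) {x..y}"
          using exp_int[OF xy, of "u R" "-k" R] xy that by (simp add: \<psi>_right)
        then show ?thesis
          by (rule spike) (use that in \<open>auto simp: \<psi>_right\<close>)
      qed
    qed (use \<open>0 < R\<close> in auto)
    show "((\<lambda>t. (k\<^sup>2 - V t) * \<psi> t) has_integral \<psi>' y - \<psi>' x) {x..y}" if "x \<le> y" for x y
    proof (rule has_integral_increment_glue[of "-R" _ \<psi>' R, OF _ _ _ _ that])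
      fix x y :: real
      assume xy: "x \<le> y"
      let ?f = "\<lambda>t. (k\<^sup>2 - V t) * \<psi> t"
      show "(?f has_integral \<psi>' y - \<psi>' x) {x..y}" if "y \<le> -R"
      proof -
        have "((\<lambda>t. k * (k * exp (k * (t - -R)))) has_integral \<psi>' y - \<psi>' x) {x..y}"
          using exp_int[OF xy, of k k "-R"] xy that by (simp add: \<psi>_left)
        then show ?thesis
          by (rule spike) (use that V in \<open>auto simp: \<psi>_left power2_eq_square\<close>)
      qed
      show "(?f has_integral \<psi>' y - \<psi>' x) {x..y}" if "-R \<le> x" "y \<le> R"
      proof -
        have "((\<lambda>t. (k\<^sup>2 - V t) * u t) has_integral \<psi>' y - \<psi>' x) {x..y}"
          using v[OF that(1) xy that(2)] xy that by (simp add: \<psi>_mid)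
        then show ?thesis
          by (rule spike) (use that in \<open>auto simp: \<psi>_mid\<close>)
      qed
      show "(?f has_integral \<psi>' y - \<psi>' x) {x..y}" if "R \<le> x"
      proof -
        have "((\<lambda>t. - k * u R * (- k * exp (- k * (t - R)))) has_integral \<psi>' y - \<psi>' x) {x..y}"
          using exp_int[OF xy, of "- k * u R" "-k" R] xy that by (simp add: \<psi>_right)
        then show ?thesis
          by (rule spike) (use that V in \<open>auto simp: \<psi>_right power2_eq_square\<close>)
      qed
    qed (use \<open>0 < R\<close> in auto)
  qed (use bound in auto)
qed

subsection \<open>Weak derivatives and square integrability\<close>

text \<open>A bridge between the Lebesgue integrals in the definition of weak derivatives and the
  gauge integrals in which primitives are expressed.\<close>

lemma lebesgue_integral_eq_integral_Icc:
  fixes h :: "real \<Rightarrow> real"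
  assumes h: "h \<in> borel_measurable lebesgue" "\<And>x. x \<in> {a..b} \<Longrightarrow> \<bar>h x\<bar> \<le> M"
    and "\<And>x. x \<notin> {a..b} \<Longrightarrow> h x = 0"
  shows "integrable lebesgue h" "(LINT x|lebesgue. h x) = integral {a..b} h"
proof -
  have eq: "h = (\<lambda>x. indicator {a..b} x *\<^sub>R h x)"
    using assms(3) by (auto simp: indicator_def fun_eq_iff)
  have "set_integrable lebesgue {a..b} h"
    unfolding set_integrable_def
  proof (rule Bochner_Integration.integrable_bound[of _ "\<lambda>x. indicator {a..b} x * M"])
    show "integrable lebesgue (\<lambda>x. indicator {a..b} x * M)"
      by (intro integrable_mult_left) (auto simp: integrable_indicator_iff emeasure_lborel_Icc_eq)
    show "(\<lambda>x. indicator {a..b} x *\<^sub>R h x) \<in> borel_measurable lebesgue"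
      using h(1) eq by metis
    show "AE x in lebesgue. norm (indicator {a..b} x *\<^sub>R h x) \<le> norm (indicator {a..b} x * M)"
      using h(2) by (intro AE_I2) (force simp: indicator_def)
  qed
  then show "integrable lebesgue h" "(LINT x|lebesgue. h x) = integral {a..b} h"
    using set_lebesgue_integral_eq_integral(2)[of "{a..b}" h] eq
    by (simp_all add: set_integrable_def set_lebesgue_integral_def)
qed

lemma continuous_borel_measurable_lebesgue:
  fixes h :: "real \<Rightarrow> real"
  assumes "continuous_on UNIV h"
  shows "h \<in> borel_measurable lebesgue"
  using assms by (intro measurable_completion) (simp add: borel_measurable_continuous_onI)

text \<open>A bounded density makes the primitive Lipschitz.\<close>

lemma bounded_primitive_continuous:
  fixes f f' :: "real \<Rightarrow> real"
  assumes "\<And>x. \<bar>f' x\<bar> \<le> M" "\<And>x y. x \<le> y \<Longrightarrow> (f' has_integral f y - f x) {x..y}"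
  shows "continuous_on UNIV f"
proof (rule lipschitz_on_continuous_on[OF lipschitz_onI])
  show "0 \<le> M" using assms(1)[of 0] by simp
  have *: "\<bar>f y - f x\<bar> \<le> M * (y - x)" if "x \<le> y" for x y
    using abs_has_integral_le[OF assms(2)[OF that] that assms(1)] .
  show "dist (f x) (f y) \<le> M * dist x y" for x y
    using *[of x y] *[of y x] by (cases "x \<le> y") (auto simp: dist_real_def abs_minus_commute)
qed

lemma locally_integrable_of_real:
  fixes f :: "real \<Rightarrow> real"
  assumes "f \<in> borel_measurable lebesgue" "\<And>x. \<bar>f x\<bar> \<le> M"
  shows "locally_integrable (\<lambda>x. of_real (f x))"
  unfolding locally_integrable_def set_integrable_def
proof (intro allI impI)
  fix S :: "real set"
  assume "compact S"
  then obtain a b where ab: "S \<subseteq> {a..b}"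
    using compact_imp_bounded bounded_subset_cbox_symmetric by (metis cbox_interval)
  have S: "S \<in> sets lebesgue" using \<open>compact S\<close> by (simp add: lmeasurable_compact fmeasurableD)
  have "integrable lebesgue (\<lambda>x. indicator S x * f x)"
  proof (rule lebesgue_integral_eq_integral_Icc(1)[of _ a b M])
    show "(\<lambda>x. indicator S x * f x) \<in> borel_measurable lebesgue"
      using S assms(1) by (intro borel_measurable_times borel_measurable_indicator)
    show "\<bar>indicator S x * f x\<bar> \<le> M" for x
      using assms(2)[of x] by (auto simp: indicator_def)
  qed (use ab in \<open>auto simp: indicator_def\<close>)
  then have "integrable lebesgue (\<lambda>x. complex_of_real (indicator S x * f x))"
    by (rule integrable_of_real)
  then show "integrable lebesgue (\<lambda>x. indicator S x *\<^sub>R complex_of_real (f x))"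
    by (simp add: scaleR_conv_of_real)
qed

lemma test_functionD:
  assumes "test_function \<phi>"
  obtains A where "0 < A" "\<And>x. (\<phi> has_real_derivative deriv \<phi> x) (at x)"
    "continuous_on UNIV \<phi>" "continuous_on UNIV (deriv \<phi>)"
    "\<And>x. A \<le> \<bar>x\<bar> \<Longrightarrow> \<phi> x = 0" "\<And>x. A \<le> \<bar>x\<bar> \<Longrightarrow> deriv \<phi> x = 0"
proof -
  have d: "(deriv ^^ n) \<phi> differentiable_on UNIV" for n
    using assms by (simp add: test_function_def)
  have "bounded {x. \<phi> x \<noteq> 0}"
    using assms compact_imp_bounded bounded_closure_image closure_subset bounded_subset
    unfolding test_function_def by metis
  then obtain B where B: "\<And>x. \<phi> x \<noteq> 0 \<Longrightarrow> \<bar>x\<bar> \<le> B"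
    unfolding bounded_iff by auto
  have D: "(\<phi> has_real_derivative deriv \<phi> x) (at x)" for x
    using d[of 0] by (simp add: differentiable_on_def real_differentiable_def DERIV_deriv_iff_real_differentiable)
  \<comment> \<open>The extra 1 puts every \<open>x\<close> with
    \<open>A \<le> \<bar>x\<bar>\<close> into an open set on which \<phi> vanishes, so the
    derivative vanishes there as well.\<close>
  define A where "A = \<bar>B\<bar> + 1"
  show thesis
  proof
    show "0 < A" by (simp add: A_def)
    show "(\<phi> has_real_derivative deriv \<phi> x) (at x)" for x by (rule D)
    show "continuous_on UNIV \<phi>" "continuous_on UNIV (deriv \<phi>)"
      using d[of 0] d[of 1] by (auto intro: differentiable_imp_continuous_on)
    show "\<phi> x = 0" if "A \<le> \<bar>x\<bar>" for x
    proof (rule ccontr)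
      assume "\<phi> x \<noteq> 0"
      from B[OF this] that show False by (simp add: A_def)
    qed
    show "deriv \<phi> x = 0" if "A \<le> \<bar>x\<bar>" for x
    proof (rule DERIV_unique[OF D])
      show "(\<phi> has_real_derivative 0) (at x)"
      proof (rule has_field_derivative_transform_within_open[of "\<lambda>_. 0"])
        show "open {y. \<bar>B\<bar> < \<bar>y\<bar>}"
          by (intro open_Collect_less continuous_intros)
        show "0 = \<phi> y" if "y \<in> {y. \<bar>B\<bar> < \<bar>y\<bar>}" for y
          using B[of y] that by force
      qed (use that in \<open>auto simp: A_def\<close>)
    qed
  qed
qed

text \<open>Integration by parts against \<phi> on an interval containing its support: the boundary
  terms are zero because \<phi> vanishes at both ends.\<close>

lemma primitive_has_weak_derivative:
  fixes f f' :: "real \<Rightarrow> real"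
  assumes f': "f' \<in> borel_measurable lebesgue" "\<And>x. \<bar>f' x\<bar> \<le> M" and f: "\<And>x. \<bar>f x\<bar> \<le> M"
    and ff': "\<And>x y. x \<le> y \<Longrightarrow> (f' has_integral f y - f x) {x..y}"
  shows "has_weak_derivative (\<lambda>x. of_real (f x)) (\<lambda>x. of_real (f' x))"
  unfolding has_weak_derivative_def
proof (intro conjI allI impI)
  have f_meas: "f \<in> borel_measurable lebesgue"
    by (rule continuous_borel_measurable_lebesgue[OF bounded_primitive_continuous[OF f'(2) ff']])
  show "locally_integrable (\<lambda>x. of_real (f x))" "locally_integrable (\<lambda>x. of_real (f' x))"
    using f_meas f f' by (auto intro: locally_integrable_of_real)
  fix \<phi> assume "test_function \<phi>"
  then obtain A where A: "0 < A" and D: "\<And>x. (\<phi> has_real_derivative deriv \<phi> x) (at x)"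
    and c: "continuous_on UNIV \<phi>" "continuous_on UNIV (deriv \<phi>)"
    and z: "\<And>x. A \<le> \<bar>x\<bar> \<Longrightarrow> \<phi> x = 0" "\<And>x. A \<le> \<bar>x\<bar> \<Longrightarrow> deriv \<phi> x = 0"
    using test_functionD by metis
  have m: "\<phi> \<in> borel_measurable lebesgue" "deriv \<phi> \<in> borel_measurable lebesgue"
    by (intro continuous_borel_measurable_lebesgue c)+
  obtain N1 where N1: "\<And>x. x \<in> {-A..A} \<Longrightarrow> \<bar>deriv \<phi> x\<bar> \<le> N1"
    using continuous_on_compact_abs_bound[OF continuous_on_subset[OF c(2) subset_UNIV] compact_Icc] by metis
  obtain N2 where N2: "\<And>x. x \<in> {-A..A} \<Longrightarrow> \<bar>\<phi> x\<bar> \<le> N2"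
    using continuous_on_compact_abs_bound[OF continuous_on_subset[OF c(1) subset_UNIV] compact_Icc] by metis
  have "0 \<le> M" "0 \<le> N1" "0 \<le> N2" using f[of 0] N1[of A] N2[of A] A by auto
  have 1: "integrable lebesgue (\<lambda>x. deriv \<phi> x * f x)" "(LINT x|lebesgue. deriv \<phi> x * f x) = integral {-A..A} (\<lambda>x. deriv \<phi> x * f x)"
    by (rule lebesgue_integral_eq_integral_Icc[of _ "-A" A "N1 * M"];
        use m f_meas N1 f z(2) \<open>0 \<le> M\<close> \<open>0 \<le> N1\<close> in \<open>auto simp: abs_mult intro!: mult_mono\<close>)+
  have 2: "integrable lebesgue (\<lambda>x. \<phi> x * f' x)" "(LINT x|lebesgue. \<phi> x * f' x) = integral {-A..A} (\<lambda>x. \<phi> x * f' x)"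
    by (rule lebesgue_integral_eq_integral_Icc[of _ "-A" A "N2 * M"];
        use m f' N2 z(1) \<open>0 \<le> M\<close> \<open>0 \<le> N2\<close> in \<open>auto simp: abs_mult intro!: mult_mono\<close>)+
  have "((\<lambda>t. deriv \<phi> t * f t + \<phi> t * f' t) has_integral \<phi> A * f A - \<phi> (-A) * f (-A)) {-A..A}"
  proof (rule has_integral_product_of_primitives[where M = "max N1 M"])
    show "(deriv \<phi> has_integral \<phi> y - \<phi> x) {x..y}" if "x \<le> y" for x y
      using that has_field_derivative_at_within[OF D]
      by (intro fundamental_theorem_of_calculus) (auto simp flip: has_real_derivative_iff_has_vector_derivative)
  qed (use A m f' N1 ff' in \<open>auto simp: le_max_iff_disj\<close>)
  then have "integral {-A..A} (\<lambda>t. deriv \<phi> t * f t + \<phi> t * f' t) = 0"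
    using z(1)[of A] z(1)[of "-A"] A by (simp add: integral_unique)
  moreover have "(LINT x|lebesgue. deriv \<phi> x * f x + \<phi> x * f' x) = integral {-A..A} (\<lambda>t. deriv \<phi> t * f t + \<phi> t * f' t)"
  proof -
    have "(\<lambda>t. deriv \<phi> t * f t + \<phi> t * f' t) \<in> borel_measurable lebesgue"
      using m f_meas f'(1) by measurable
    then show ?thesis
      using N1 N2 f f'(2) z \<open>0 \<le> M\<close> \<open>0 \<le> N1\<close> \<open>0 \<le> N2\<close>
      by (intro lebesgue_integral_eq_integral_Icc(2)[of _ "-A" A "N1 * M + N2 * M"])
         (auto simp: abs_mult intro!: mult_mono add_mono order_trans[OF abs_triangle_ineq])
  qed
  ultimately have "(LINT x|lebesgue. deriv \<phi> x * f x) = - (LINT x|lebesgue. \<phi> x * f' x)"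
    using 1(1) 2(1) by simp
  then have "complex_of_real (LINT x|lebesgue. deriv \<phi> x * f x) = - complex_of_real (LINT x|lebesgue. \<phi> x * f' x)"
    by simp
  then show "(LINT x|lebesgue. deriv \<phi> x *\<^sub>R complex_of_real (f x)) = - (LINT x|lebesgue. \<phi> x *\<^sub>R complex_of_real (f' x))"
    by (simp add: scaleR_conv_of_real flip: of_real_mult integral_complex_of_real)
qed

lemma integrable_exp_minus_abs:
  assumes "0 < (k::real)"
  shows "integrable lebesgue (\<lambda>x. exp (- k * \<bar>x\<bar>))"
proof -
  let ?h = "\<lambda>x. indicator {0..} x * exp (- k * x)"
  have m: "?h \<in> borel_measurable borel" by measurable
  have "set_integrable lebesgue {0..} (\<lambda>x. exp (- k * x))"
    by (rule nonnegative_absolutely_integrable_1[OF integrable_on_exp_minus_to_infinity[OF assms]]) simp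
  then have 1: "integrable lborel ?h"
    using m integrable_completion[of ?h lborel] by (simp add: set_integrable_def)
  then have 2: "integrable lborel (\<lambda>x. ?h (0 + (-1) * x))"
    by (subst lborel_integrable_real_affine_iff) auto
  \<comment> \<open>Comparison instead of equality: the two half-line functions both count the point
    0.\<close>
  have "integrable lborel (\<lambda>x. exp (- k * \<bar>x\<bar>))"
    by (rule Bochner_Integration.integrable_bound[OF Bochner_Integration.integrable_add[OF 1 2]])
       (auto simp: indicator_def)
  then show ?thesis
    by (subst integrable_completion) auto
qed

lemma L2_of_exponential_decay:
  fixes f :: "real \<Rightarrow> real"
  assumes "0 < k" and f: "f \<in> borel_measurable lebesgue" "\<And>x. \<bar>f x\<bar> \<le> K * exp (- k * \<bar>x\<bar>)"
  shows "integrable lebesgue (\<lambda>x. (f x)\<^sup>2)" "L2 lebesgue (\<lambda>x. of_real (f x))"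
proof -
  show i: "integrable lebesgue (\<lambda>x. (f x)\<^sup>2)"
  proof (rule Bochner_Integration.integrable_bound)
    show "integrable lebesgue (\<lambda>x. K\<^sup>2 * exp (- (2 * k) * \<bar>x\<bar>))"
      using \<open>0 < k\<close> by (intro integrable_mult_right integrable_exp_minus_abs) simp
    show "(\<lambda>x. (f x)\<^sup>2) \<in> borel_measurable lebesgue" using f(1) by measurable
    have "(f x)\<^sup>2 \<le> K\<^sup>2 * exp (- (2 * k) * \<bar>x\<bar>)" for x
    proof -
      have "\<bar>f x\<bar>\<^sup>2 \<le> (K * exp (- k * \<bar>x\<bar>))\<^sup>2" by (rule power_mono[OF f(2)]) simp
      then show ?thesis by (simp add: power_mult_distrib flip: exp_double) (simp add: mult_ac)
    qed
    then show "AE x in lebesgue. norm ((f x)\<^sup>2) \<le> norm (K\<^sup>2 * exp (- (2 * k) * \<bar>x\<bar>))"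
      by (intro AE_I2) (simp add: abs_mult)
  qed
  then show "L2 lebesgue (\<lambda>x. of_real (f x))"
    using f(1) by (simp add: L2_def norm_of_real)
qed

subsection \<open>Bound states\<close>

text \<open>The integral identities turn \<psi>' and \<open>q * \<psi>\<close> into weak
  derivatives, exponential decay gives square integrability, and the choice of \<alpha> solves the
  second equation identically. The coefficient \<open>q\<close> is bounded everywhere but tied to
  \<rho> only almost everywhere, so a convenient representative may be used.\<close>

lemma bound_state_of_decaying_solution:
  fixes \<psi> \<psi>' q \<rho> :: "real \<Rightarrow> real"
  assumes "0 < k" "\<omega> \<noteq> \<Omega>"
    and pos: "\<And>x. 0 < \<psi> x"
    and bound: "\<And>x. \<bar>\<psi> x\<bar> \<le> K * exp (- k * \<bar>x\<bar>)" "\<And>x. \<bar>\<psi>' x\<bar> \<le> K * exp (- k * \<bar>x\<bar>)"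
    and q: "q \<in> borel_measurable lebesgue" "\<And>x. \<bar>q x\<bar> \<le> Q"
    and \<psi>: "\<And>x y. x \<le> y \<Longrightarrow> (\<psi>' has_integral \<psi> y - \<psi> x) {x..y}"
    and \<psi>': "\<And>x y. x \<le> y \<Longrightarrow> ((\<lambda>t. q t * \<psi> t) has_integral \<psi>' y - \<psi>' x) {x..y}"
    and \<rho>: "\<rho> \<in> borel_measurable lebesgue" "AE x in lebesgue. 0 \<le> \<rho> x" "AE x in lebesgue. \<rho> x \<le> D"
    and eq: "AE x in lebesgue. q x = g\<^sup>2 * \<rho> x / (\<omega> - \<Omega>) - \<omega>"
  shows "bound_state g \<Omega> \<rho> \<omega> (\<lambda>x. of_real (\<psi> x)) (\<lambda>x. of_real (g * \<psi> x / (\<omega> - \<Omega>)))"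
proof -
  have "0 \<le> Q" using q(2)[of 0] by simp
  have "0 \<le> K" using pos[of 0] bound(1)[of 0] by simp
  have Kb: "K * exp (- k * \<bar>x\<bar>) \<le> K" for x
    using \<open>0 \<le> K\<close> \<open>0 < k\<close> mult_left_mono[of "exp (- k * \<bar>x\<bar>)" 1 K] by simp
  have b\<psi>'': "\<bar>q x * \<psi> x\<bar> \<le> (Q * K) * exp (- k * \<bar>x\<bar>)" for x
    unfolding abs_mult mult.assoc using q(2) bound(1) \<open>0 \<le> Q\<close> by (intro mult_mono) auto
  have Qb: "(Q * K) * exp (- k * \<bar>x\<bar>) \<le> Q * K" for x
    using Kb[of x] \<open>0 \<le> Q\<close> by (simp add: mult.assoc mult_left_mono)
  define M where "M = max K (Q * K)"
  have M: "\<bar>\<psi> x\<bar> \<le> M" "\<bar>\<psi>' x\<bar> \<le> M" "\<bar>q x * \<psi> x\<bar> \<le> M" for x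
    using order_trans[OF bound(1) Kb] order_trans[OF bound(2) Kb] order_trans[OF b\<psi>'' Qb]
    by (auto simp: M_def le_max_iff_disj)
  have m: "\<psi> \<in> borel_measurable lebesgue" "\<psi>' \<in> borel_measurable lebesgue"
    using bounded_primitive_continuous[OF M(2) \<psi>] bounded_primitive_continuous[OF M(3) \<psi>']
    by (auto intro: continuous_borel_measurable_lebesgue)
  have m2: "(\<lambda>x. q x * \<psi> x) \<in> borel_measurable lebesgue" using q(1) m(1) by measurable
  let ?\<alpha> = "\<lambda>x. complex_of_real (g * \<psi> x / (\<omega> - \<Omega>))"
  have "L2 (weighted \<rho>) ?\<alpha>"
    unfolding L2_def
  proof
    show "?\<alpha> \<in> borel_measurable (weighted \<rho>)"
      unfolding weighted_def measurable_density_eq1 using m(1) by measurable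
    \<comment> \<open>Because \<rho> is nonnegative almost everywhere, the truncation by
      \<open>ennreal\<close> is harmless and integrability for \<open>weighted \<rho>\<close>
      becomes this statement.\<close>
    have "integrable lebesgue (\<lambda>x. \<rho> x *\<^sub>R (g * \<psi> x / (\<omega> - \<Omega>))\<^sup>2)"
    proof (rule Bochner_Integration.integrable_bound)
      show "integrable lebesgue (\<lambda>x. (D * (g / (\<omega> - \<Omega>))\<^sup>2) * (\<psi> x)\<^sup>2)"
        by (intro integrable_mult_right L2_of_exponential_decay(1)[OF \<open>0 < k\<close> m(1) bound(1)])
      show "(\<lambda>x. \<rho> x *\<^sub>R (g * \<psi> x / (\<omega> - \<Omega>))\<^sup>2) \<in> borel_measurable lebesgue"
        using \<rho>(1) m(1) by measurable
      show "AE x in lebesgue. norm (\<rho> x *\<^sub>R (g * \<psi> x / (\<omega> - \<Omega>))\<^sup>2) \<le> norm ((D * (g / (\<omega> - \<Omega>))\<^sup>2) * (\<psi> x)\<^sup>2)"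
        using \<rho>(2,3)
      proof eventually_elim
        case (elim x)
        then have "\<rho> x * (g * \<psi> x / (\<omega> - \<Omega>))\<^sup>2 \<le> D * (g * \<psi> x / (\<omega> - \<Omega>))\<^sup>2"
          by (intro mult_right_mono) auto
        with elim show ?case by (simp add: abs_mult power_mult_distrib power_divide mult_ac)
      qed
    qed
    then show "integrable (weighted \<rho>) (\<lambda>x. (norm (?\<alpha> x))\<^sup>2)"
      unfolding weighted_def norm_of_real power2_abs
      using \<rho>(1,2) m(1) by (subst integrable_density) auto
  qed
  moreover have "AE x in lebesgue. - complex_of_real (q x * \<psi> x) + of_real (g * \<rho> x) * ?\<alpha> x = of_real \<omega> * of_real (\<psi> x)"
    using eq
  proof eventually_elim
    case (elim x)
    have "- (q x * \<psi> x) + (g * \<rho> x) * (g * \<psi> x / (\<omega> - \<Omega>)) = \<omega> * \<psi> x"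
      unfolding elim by (simp add: algebra_simps power2_eq_square)
    then show ?case
      by (metis of_real_add of_real_minus of_real_mult)
  qed
  moreover have "of_real g * of_real (\<psi> x) + of_real \<Omega> * ?\<alpha> x = of_real \<omega> * ?\<alpha> x" for x
  proof -
    have "g * \<psi> x + \<Omega> * (g * \<psi> x / (\<omega> - \<Omega>)) = \<omega> * (g * \<psi> x / (\<omega> - \<Omega>))"
      using \<open>\<omega> \<noteq> \<Omega>\<close> by (simp add: field_simps)
    then show ?thesis by (metis of_real_add of_real_mult)
  qed
  moreover have "has_weak_derivative (\<lambda>x. of_real (\<psi> x)) (\<lambda>x. of_real (\<psi>' x))"
    by (rule primitive_has_weak_derivative[OF m(2) M(2,1) \<psi>])
  moreover have "has_weak_derivative (\<lambda>x. of_real (\<psi>' x)) (\<lambda>x. of_real (q x * \<psi> x))"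
    by (rule primitive_has_weak_derivative[OF m2 M(3,2) \<psi>'])
  moreover have "L2 lebesgue (\<lambda>x. of_real (\<psi> x))" "L2 lebesgue (\<lambda>x. of_real (\<psi>' x))"
      "L2 lebesgue (\<lambda>x. of_real (q x * \<psi> x))"
    by (rule L2_of_exponential_decay(2)[OF \<open>0 < k\<close>], (fact m m2 bound b\<psi>'')+)+
  ultimately have "solves_system g \<Omega> \<rho> \<omega> (\<lambda>x. of_real (\<psi> x)) ?\<alpha>"
    unfolding solves_system_def by blast
  moreover have "\<not> (AE x in lebesgue. complex_of_real (\<psi> x) = 0)"
  proof
    assume "AE x in lebesgue. complex_of_real (\<psi> x) = 0"
    then have "AE x in (lebesgue :: real measure). False"
      by (rule eventually_mono) (use pos in \<open>simp add: less_le\<close>)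
    then have "emeasure (lebesgue :: real measure) UNIV = 0"
      using ae_filter_eq_bot_iff[of "lebesgue :: real measure"] by (simp add: eventually_False)
    then show False by simp
  qed
  ultimately show ?thesis by (simp add: bound_state_def)
qed

text \<open>Here \<sigma> is the sign of \<rho>1, which merges the two parts: the coupling is
  \<open>- \<sigma> * g\<^sup>2 / (w - \<Omega>)\<close>, positive at the edge by
  \<open>\<sigma>_sign\<close>. The hypothesis \<open>pa\<close> covers every value \<open>t\<close>
  that the magnitude of \<rho>1 may take.\<close>

lemma bound_state_exists_between:
  fixes g \<Omega> \<rho>0 \<sigma> a b C D R :: real and \<rho> \<rho>1 :: "real \<Rightarrow> real"
  assumes "a < b" "0 < R" "0 \<le> C" "\<Omega> \<notin> {a..b}" "\<bar>\<sigma>\<bar> = 1"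
    and \<rho>: "\<And>x. \<rho> x = \<rho>0 + \<rho>1 x" "\<rho>1 \<in> borel_measurable lebesgue"
      "AE x in lebesgue. 0 \<le> \<rho> x" "AE x in lebesgue. \<rho> x \<le> D"
    and \<rho>1: "AE x in lebesgue. 0 \<le> \<sigma> * \<rho>1 x" "AE x in lebesgue. \<sigma> * \<rho>1 x \<le> C"
      "AE x in lebesgue. x \<notin> {-R..R} \<longrightarrow> \<rho>1 x = 0" "\<not> (AE x in lebesgue. \<rho>1 x = 0)"
    and p: "\<And>w. a \<le> w \<Longrightarrow> w < b \<Longrightarrow> 0 < g\<^sup>2 * \<rho>0 / (w - \<Omega>) - w" "g\<^sup>2 * \<rho>0 / (b - \<Omega>) - b = 0"
    and \<sigma>_sign: "0 < - \<sigma> * g\<^sup>2 / (b - \<Omega>)"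
    and pa: "\<And>t. 0 \<le> t \<Longrightarrow> t \<le> C \<Longrightarrow> 0 \<le> g\<^sup>2 * (\<rho>0 + \<sigma> * t) / (a - \<Omega>) - a"
  shows "\<exists>\<omega>. a < \<omega> \<and> \<omega> < b \<and> (\<exists>\<psi> \<alpha>. bound_state g \<Omega> \<rho> \<omega> \<psi> \<alpha>)"
proof -
  \<comment> \<open>A representative of \<open>\<sigma> * \<rho>1\<close>, truncated and cut off so
    that the bounds and the support condition hold at every point, as shooting demands.\<close>
  define W where "W = (\<lambda>x. indicator {-R..R} x * max 0 (min C (\<sigma> * \<rho>1 x)))"
  define P where "P = (\<lambda>w. g\<^sup>2 * \<rho>0 / (w - \<Omega>) - w)"
  define c where "c = (\<lambda>w. - \<sigma> * g\<^sup>2 / (w - \<Omega>))"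
  have Pc: "P w - c w * t = g\<^sup>2 * (\<rho>0 + \<sigma> * t) / (w - \<Omega>) - w" for w t
    by (simp add: P_def c_def algebra_simps add_divide_distrib)
  have \<sigma>: "\<sigma> * \<sigma> = 1" using \<open>\<bar>\<sigma>\<bar> = 1\<close> by (metis abs_mult_self_eq mult_1)
  have W: "W \<in> borel_measurable lebesgue"
    unfolding W_def using \<rho>(2)
    by (intro borel_measurable_times borel_measurable_indicator borel_measurable_max borel_measurable_min) auto
  have W_bounds: "0 \<le> W t" "W t \<le> C" for t
    using \<open>0 \<le> C\<close> by (auto simp: W_def indicator_def)
  have W_supp: "W t = 0" if "t \<notin> {-R..R}" for t using that by (simp add: W_def)
  have W_eq: "AE x in lebesgue. \<rho>1 x = \<sigma> * W x"
    using \<rho>1(1-3)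
  proof eventually_elim
    case (elim x)
    have "\<sigma> * (\<sigma> * \<rho>1 x) = \<rho>1 x" by (simp add: \<sigma> flip: mult.assoc)
    with elim show ?case by (cases "x \<in> {-R..R}") (auto simp: W_def)
  qed
  have W_nz: "\<not> (AE x in lebesgue. W x = 0)"
  proof
    assume "AE x in lebesgue. W x = 0"
    with W_eq have "AE x in lebesgue. \<rho>1 x = 0" by eventually_elim simp
    with \<rho>1(4) show False by simp
  qed
  have cont: "continuous_on {a..b} P" "continuous_on {a..b} c"
    unfolding P_def c_def using \<open>\<Omega> \<notin> {a..b}\<close> by (auto intro!: continuous_intros)
  have pa': "0 \<le> P a - c a * W t" for t
    unfolding Pc by (rule pa[OF W_bounds])
  have P: "\<And>w. a \<le> w \<Longrightarrow> w < b \<Longrightarrow> 0 < P w" "P b = 0" and cb: "0 < c b"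
    using p \<sigma>_sign by (auto simp: P_def c_def)
  obtain w u v where w: "a < w" "w < b"
    and bc: "u (-R) = 1" "v (-R) = sqrt (P w)" "v R = - sqrt (P w) * u R"
    and u_pos: "\<And>x. x \<in> {-R..R} \<Longrightarrow> 0 < u x"
    and contuv: "continuous_on {-R..R} u" "continuous_on {-R..R} v"
    and u: "\<And>x y. -R \<le> x \<Longrightarrow> x \<le> y \<Longrightarrow> y \<le> R \<Longrightarrow> (v has_integral u y - u x) {x..y}"
    and v: "\<And>x y. -R \<le> x \<Longrightarrow> x \<le> y \<Longrightarrow> y \<le> R \<Longrightarrow>
          ((\<lambda>t. (P w - c w * W t) * u t) has_integral v y - v x) {x..y}"
    by (rule shooting_ground_state[OF \<open>a < b\<close> \<open>0 < R\<close> cont P cb W W_bounds W_supp W_nz pa'])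
       blast+
  define k where "k = sqrt (P w)"
  have "0 < P w" using p(1)[of w] w by (simp add: P_def)
  then have k: "0 < k" "P w = k\<^sup>2" by (simp_all add: k_def)
  obtain \<psi> \<psi>' K where \<psi>: "\<And>x. 0 < \<psi> x"
    "\<And>x. \<bar>\<psi> x\<bar> \<le> K * exp (- k * \<bar>x\<bar>)" "\<And>x. \<bar>\<psi>' x\<bar> \<le> K * exp (- k * \<bar>x\<bar>)"
    "\<And>x y. x \<le> y \<Longrightarrow> (\<psi>' has_integral \<psi> y - \<psi> x) {x..y}"
    "\<And>x y. x \<le> y \<Longrightarrow> ((\<lambda>t. (k\<^sup>2 - c w * W t) * \<psi> t) has_integral \<psi>' y - \<psi>' x) {x..y}"
    by (rule exponential_extension[OF \<open>0 < R\<close> \<open>0 < k\<close> _ bc[folded k_def] u_pos contuv u v[unfolded k(2)]])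
       (auto simp: W_supp)
  have "bound_state g \<Omega> \<rho> w (\<lambda>x. of_real (\<psi> x)) (\<lambda>x. of_real (g * \<psi> x / (w - \<Omega>)))"
  proof (rule bound_state_of_decaying_solution[OF \<open>0 < k\<close> _ \<psi>(1-3) _ _ \<psi>(4,5) _ _ \<rho>(4)])
    show "w \<noteq> \<Omega>" using w \<open>\<Omega> \<notin> {a..b}\<close> by auto
    show "(\<lambda>t. k\<^sup>2 - c w * W t) \<in> borel_measurable lebesgue" using W by measurable
    show "\<bar>k\<^sup>2 - c w * W t\<bar> \<le> k\<^sup>2 + \<bar>c w\<bar> * C" for t
    proof -
      have "\<bar>c w * W t\<bar> \<le> \<bar>c w\<bar> * C" unfolding abs_mult using W_bounds[of t] by (intro mult_left_mono) auto
      moreover have "0 \<le> k\<^sup>2" by simp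
      ultimately show ?thesis by linarith
    qed
    show "\<rho> \<in> borel_measurable lebesgue"
      using \<rho>(1,2) by (subst ext[of \<rho> "\<lambda>x. \<rho>0 + \<rho>1 x"]) auto
    show "AE x in lebesgue. k\<^sup>2 - c w * W x = g\<^sup>2 * \<rho> x / (w - \<Omega>) - w"
      using W_eq by eventually_elim (simp add: \<rho>(1) Pc flip: k(2))
  qed (use \<rho>(3) in auto)
  with w show ?thesis by blast
qed

theorem theorem1:
  fixes g \<Omega> \<rho>0 :: real and \<rho> \<rho>1 :: "real \<Rightarrow> real"
  assumes "g > 0" and "\<Omega> > 0" and "\<rho>0 > 0"
    and "Linf_c \<rho>1"
    and "\<And>x. \<rho> x = \<rho>0 + \<rho>1 x"
  shows "((AE x in lebesgue. \<rho>1 x \<ge> 0) \<and> \<not> (AE x in lebesgue. \<rho>1 x = 0)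
            \<longrightarrow> (\<exists>\<omega>\<in>G_minus g \<Omega> \<rho>0. \<exists>\<psi> \<alpha>. bound_state g \<Omega> \<rho> \<omega> \<psi> \<alpha>))
       \<and> ((AE x in lebesgue. \<rho>1 x \<le> 0) \<and> \<not> (AE x in lebesgue. \<rho>1 x = 0)
            \<and> (\<exists>\<rho>s>0. AE x in lebesgue. \<rho> x \<ge> \<rho>s)
            \<longrightarrow> (\<exists>\<omega>\<in>G_plus g \<Omega> \<rho>0. \<exists>\<psi> \<alpha>. bound_state g \<Omega> \<rho> \<omega> \<psi> \<alpha>))"
proof -
  note \<rho> = assms(5)
  obtain C0 S where meas: "\<rho>1 \<in> borel_measurable lebesgue"
    and C0: "AE x in lebesgue. \<bar>\<rho>1 x\<bar> \<le> C0"
    and S: "compact S" "AE x in lebesgue. x \<notin> S \<longrightarrow> \<rho>1 x = 0"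
    using assms(4) unfolding Linf_c_def by blast
  obtain R0 where "\<forall>x\<in>S. norm x \<le> R0"
    using compact_imp_bounded[OF S(1)] unfolding bounded_iff by blast
  then have R0: "\<bar>x\<bar> \<le> R0" if "x \<in> S" for x using that by auto
  define R where "R = \<bar>R0\<bar> + 1"
  have "0 < R" by (simp add: R_def)
  have supp: "AE x in lebesgue. x \<notin> {-R..R} \<longrightarrow> \<rho>1 x = 0"
    using S(2)
  proof eventually_elim
    case (elim x)
    then show ?case using R0[of x] by (force simp: R_def)
  qed
  have D: "AE x in lebesgue. \<rho> x \<le> \<rho>0 + C0"
    using C0 by eventually_elim (simp add: \<rho>)
  define m where "m = omega_minus g \<Omega> \<rho>0"
  define M where "M = omega_plus g \<Omega> \<rho>0"
  let ?r = "sqrt (\<Omega>\<^sup>2 + 4 * g\<^sup>2 * \<rho>0)"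
  have gr: "0 < g\<^sup>2 * \<rho>0" using assms(1,3) by simp
  have "\<Omega> < ?r" using assms(1-3) by (intro real_less_rsqrt) simp
  then have m: "m < 0" "m < \<Omega>" and M: "\<Omega> < M"
    using assms(2) by (auto simp: m_def M_def omega_minus_def omega_plus_def)
  have r2: "?r * ?r = \<Omega>\<^sup>2 + 4 * g\<^sup>2 * \<rho>0"
    using assms(3) by (simp add: abs_of_nonneg)
  \<comment> \<open>The gap edges are the roots of this quadratic, so \<open>p\<close> equals
    \<open>(w - m) * (w - M) / (\<Omega> - w)\<close>: positive for \<open>w < m\<close> and for
    \<open>\<Omega> < w < M\<close>, zero at the edges.\<close>
  have factor: "(w - m) * (w - M) = w\<^sup>2 - \<Omega> * w - g\<^sup>2 * \<rho>0" for w
    using r2 by (simp add: m_def M_def omega_minus_def omega_plus_def field_simps power2_eq_square)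
  have p: "g\<^sup>2 * \<rho>0 / (w - \<Omega>) - w = (w - m) * (w - M) / (\<Omega> - w)" if "w \<noteq> \<Omega>" for w
  proof -
    have "g\<^sup>2 * \<rho>0 / (w - \<Omega>) - w = (g\<^sup>2 * \<rho>0 - w * (w - \<Omega>)) / (w - \<Omega>)"
      using that by (simp add: diff_divide_distrib)
    also have "g\<^sup>2 * \<rho>0 - w * (w - \<Omega>) = - ((w - m) * (w - M))"
      unfolding factor by (simp add: algebra_simps power2_eq_square)
    also have "- ((w - m) * (w - M)) / (w - \<Omega>) = (w - m) * (w - M) / (\<Omega> - w)"
      by (metis minus_diff_eq minus_divide_divide minus_minus)
    finally show ?thesis .
  qed
  show ?thesis
  proof (intro conjI impI; elim conjE)
    assume pos: "AE x in lebesgue. \<rho>1 x \<ge> 0" and nz: "\<not> (AE x in lebesgue. \<rho>1 x = 0)"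
    define C where "C = \<bar>C0\<bar>"
    \<comment> \<open>Chosen so that \<open>\<Omega> - a \<ge> 1\<close> and
      \<open>- a \<ge> g\<^sup>2 * (\<rho>0 + C)\<close>; then the fraction
      \<open>g\<^sup>2 * (\<rho>0 + t) / (\<Omega> - a)\<close> is at most \<open>- a\<close> for
      all \<open>t \<le> C\<close>.\<close>
    define a where "a = m - g\<^sup>2 * (\<rho>0 + C) - 1"
    have gC: "0 \<le> g\<^sup>2 * (\<rho>0 + C)" using assms(3) by (simp add: C_def)
    have a: "a < m" "a \<le> -1" using gC m by (auto simp: a_def)
    have "\<exists>\<omega>. a < \<omega> \<and> \<omega> < m \<and> (\<exists>\<psi> \<alpha>. bound_state g \<Omega> \<rho> \<omega> \<psi> \<alpha>)"
    proof (rule bound_state_exists_between[where \<sigma> = 1, OF \<open>a < m\<close> \<open>0 < R\<close> _ _ _ \<rho> meas _ D _ _ supp nz])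
      show "AE x in lebesgue. 0 \<le> \<rho> x"
        using pos by eventually_elim (use assms(3) in \<open>simp add: \<rho>\<close>)
      show "AE x in lebesgue. 0 \<le> 1 * \<rho>1 x" using pos by simp
      show "AE x in lebesgue. 1 * \<rho>1 x \<le> C" using C0 by eventually_elim (simp add: C_def)
      show "0 < g\<^sup>2 * \<rho>0 / (w - \<Omega>) - w" if "a \<le> w" "w < m" for w
        using that m M p[of w] by (simp add: divide_pos_pos mult_neg_neg)
      show "g\<^sup>2 * \<rho>0 / (m - \<Omega>) - m = 0" using p[of m] m by simp
      show "0 < - 1 * g\<^sup>2 / (m - \<Omega>)" using m assms(1) by (simp add: divide_pos_neg)
      show "0 \<le> g\<^sup>2 * (\<rho>0 + 1 * t) / (a - \<Omega>) - a" if t: "0 \<le> t" "t \<le> C" for t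
      proof -
        have "0 \<le> g\<^sup>2 * (\<rho>0 + t)" using assms(3) t by simp
        then have "g\<^sup>2 * (\<rho>0 + t) / (\<Omega> - a) \<le> g\<^sup>2 * (\<rho>0 + t)"
          using a assms(2) by (simp add: divide_le_eq mult_le_cancel_left1 not_less)
        also have "\<dots> \<le> g\<^sup>2 * (\<rho>0 + C)" using t by (intro mult_left_mono) auto
        also have "\<dots> \<le> - a" using m by (simp add: a_def)
        finally have "g\<^sup>2 * (\<rho>0 + t) / (\<Omega> - a) \<le> - a" .
        moreover have "g\<^sup>2 * (\<rho>0 + 1 * t) / (a - \<Omega>) = - (g\<^sup>2 * (\<rho>0 + t) / (\<Omega> - a))"
          by (metis minus_diff_eq minus_divide_right mult_1)
        ultimately show ?thesis by linarith
      qed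
    qed (use m assms(2) in \<open>auto simp: C_def\<close>)
    then show "\<exists>\<omega>\<in>G_minus g \<Omega> \<rho>0. \<exists>\<psi> \<alpha>. bound_state g \<Omega> \<rho> \<omega> \<psi> \<alpha>"
      by (auto simp: G_minus_def m_def)
  next
    assume neg: "AE x in lebesgue. \<rho>1 x \<le> 0" and nz: "\<not> (AE x in lebesgue. \<rho>1 x = 0)"
      and "\<exists>\<rho>s>0. AE x in lebesgue. \<rho> x \<ge> \<rho>s"
    then obtain \<rho>s where \<rho>s: "0 < \<rho>s" "AE x in lebesgue. \<rho> x \<ge> \<rho>s" by blast
    \<comment> \<open>The minimum guarantees that the bound \<open>\<rho>0 - s\<close> for the
      magnitude of \<rho>1 is nonnegative.\<close>
    define s where "s = min \<rho>s \<rho>0"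
    have s: "0 < s" "s \<le> \<rho>0" "s \<le> \<rho>s" using \<rho>s(1) assms(3) by (auto simp: s_def)
    \<comment> \<open>The bounds 1 and \<open>g\<^sup>2 * s / (\<Omega> + 1)\<close> give
      \<open>\<Omega> + \<epsilon> \<le> \<Omega> + 1 \<le> g\<^sup>2 * s / \<epsilon>\<close>, so
      the coefficient is nonnegative at \<open>\<Omega> + \<epsilon>\<close>; half the gap keeps
      that point below the edge.\<close>
    define \<epsilon> where "\<epsilon> = min (min 1 (g\<^sup>2 * s / (\<Omega> + 1))) ((M - \<Omega>) / 2)"
    have gs: "0 < g\<^sup>2 * s" using assms(1) s by simp
    have \<epsilon>: "0 < \<epsilon>" "\<epsilon> \<le> 1" "\<epsilon> \<le> g\<^sup>2 * s / (\<Omega> + 1)" "\<epsilon> \<le> (M - \<Omega>) / 2"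
      unfolding \<epsilon>_def using gs assms(2) M by (simp, linarith+)
    then have \<epsilon>M: "\<Omega> + \<epsilon> < M" using M by (simp add: field_simps)
    have "\<exists>\<omega>. \<Omega> + \<epsilon> < \<omega> \<and> \<omega> < M \<and> (\<exists>\<psi> \<alpha>. bound_state g \<Omega> \<rho> \<omega> \<psi> \<alpha>)"
    proof (rule bound_state_exists_between[where \<sigma> = "-1" and C = "\<rho>0 - s", OF \<epsilon>M \<open>0 < R\<close> _ _ _ \<rho> meas _ D _ _ supp nz])
      show "AE x in lebesgue. 0 \<le> \<rho> x"
        using \<rho>s(2) by eventually_elim (use \<rho>s(1) in simp)
      show "AE x in lebesgue. 0 \<le> - 1 * \<rho>1 x" using neg by simp
      show "AE x in lebesgue. - 1 * \<rho>1 x \<le> \<rho>0 - s"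
        using \<rho>s(2) by eventually_elim (use s in \<open>simp add: \<rho>\<close>)
      show "0 < g\<^sup>2 * \<rho>0 / (w - \<Omega>) - w" if "\<Omega> + \<epsilon> \<le> w" "w < M" for w
        using that m \<epsilon>(1) p[of w] by (simp add: divide_neg_neg mult_pos_neg)
      show "g\<^sup>2 * \<rho>0 / (M - \<Omega>) - M = 0" using p[of M] M by simp
      show "0 < - (- 1) * g\<^sup>2 / (M - \<Omega>)" using M assms(1) by simp
      show "0 \<le> g\<^sup>2 * (\<rho>0 + - 1 * t) / (\<Omega> + \<epsilon> - \<Omega>) - (\<Omega> + \<epsilon>)" if t: "0 \<le> t" "t \<le> \<rho>0 - s" for t
      proof -
        have "\<Omega> + \<epsilon> \<le> \<Omega> + 1" using \<epsilon> by simp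
        also have "\<dots> \<le> g\<^sup>2 * s / \<epsilon>"
          using \<epsilon> assms(2) by (simp add: field_simps)
        also have "\<dots> \<le> g\<^sup>2 * (\<rho>0 - t) / \<epsilon>"
          using t \<epsilon> by (intro divide_right_mono mult_left_mono) auto
        finally show ?thesis by simp
      qed
    qed (use \<epsilon> s in auto)
    then show "\<exists>\<omega>\<in>G_plus g \<Omega> \<rho>0. \<exists>\<psi> \<alpha>. bound_state g \<Omega> \<rho> \<omega> \<psi> \<alpha>"
      using \<epsilon>(1) by (force simp: G_plus_def M_def)
  qed
qed

end
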